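(* Let $A\in IMS2(n,m)$. There exists a data structure of ${\rm O}(nm)$ bits that, given an index pair $(r,c)$, computes in ${\rm O}(\log\log n)$ time a value $h$ with $h-\log n<A[r][c]\le h$.
   Context: $IMS2(n,m)$ is the set of two-dimensional integer arrays $A[0..n-1][0..n-1]$ satisfying three conditions: - $A[i][j]\le A[i][j+1]$ for $0\le i<n$ and $0\le j<n-1$; - $A[i][j]\le A[i+1][j]$ for $0\le i<n-1$ and $0\le j<n$; - $0\le A[i][j]<m$ for all $i,j$. Space is measured in bits, in the word-RAM model. *)

theory Defs
  imports Complex_Main "HOL-Library.Landau_Symbols"
begin

definition IMS2 :: "nat \<Rightarrow> nat \<Rightarrow> (nat \<Rightarrow> nat \<Rightarrow> int) set" where
  "IMS2 n m = {A.
     (\<forall>i j. i < n \<and> j < n - 1 \<longrightarrow> A i j \<le> A i (j + 1)) \<and>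
     (\<forall>i j. i < n - 1 \<and> j < n \<longrightarrow> A i j \<le> A (i + 1) j) \<and>
     (\<forall>i j. i < n \<and> j < n \<longrightarrow> 0 \<le> A i j \<and> A i j < int m)}"

text \<open>A word-RAM with word size \<open>w\<close>. Words are the natural numbers below \<open>2 ^ w\<close>. The word size is a
  parameter of the semantics only, not of the program: one program runs on the machines of all word
  sizes. A program refers to finitely many registers; the random-access memory is addressed by the
  contents of registers, so only the first \<open>2 ^ w\<close> cells can be accessed.\<close>

datatype binop = Add | Sub | Mul | Div | Mod | And | Or | Xor | Shl | Shr

type_synonym reg = nat

datatype instr =
    Const reg nat
  | Op binop reg reg reg
  | Load reg reg
  | Store reg reg
  | Jump nat
  | JumpEq reg reg nat
  | JumpLess reg reg nat

type_synonym program = "instr list"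

datatype state = State (pc: nat) (regs: "reg \<Rightarrow> nat") (mem: "nat \<Rightarrow> nat")

text \<open>Arithmetic is unsigned and modulo \<open>2 ^ w\<close>; for words \<open>a\<close>, \<open>b\<close> the truncated subtraction in the
  equation for \<open>Sub\<close> does not truncate. Division by zero follows the convention of the type of
  natural numbers.\<close>

fun binop_sem :: "nat \<Rightarrow> binop \<Rightarrow> nat \<Rightarrow> nat \<Rightarrow> nat" where
  "binop_sem w Add a b = (a + b) mod 2 ^ w"
| "binop_sem w Sub a b = (2 ^ w + a - b) mod 2 ^ w"
| "binop_sem w Mul a b = (a * b) mod 2 ^ w"
| "binop_sem w Div a b = a div b"
| "binop_sem w Mod a b = a mod b"
| "binop_sem w And a b = and a b"
| "binop_sem w Or a b = or a b"
| "binop_sem w Xor a b = xor a b"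
| "binop_sem w Shl a b = (a * 2 ^ b) mod 2 ^ w"
| "binop_sem w Shr a b = a div 2 ^ b"

fun exec :: "nat \<Rightarrow> instr \<Rightarrow> state \<Rightarrow> state" where
  "exec w (Const d k) (State p R M) = State (p + 1) (R(d := k mod 2 ^ w)) M"
| "exec w (Op f d a b) (State p R M) = State (p + 1) (R(d := binop_sem w f (R a) (R b))) M"
| "exec w (Load d a) (State p R M) = State (p + 1) (R(d := M (R a))) M"
| "exec w (Store a b) (State p R M) = State (p + 1) R (M(R a := R b))"
| "exec w (Jump l) (State p R M) = State l R M"
| "exec w (JumpEq a b l) (State p R M) = State (if R a = R b then l else p + 1) R M"
| "exec w (JumpLess a b l) (State p R M) = State (if R a < R b then l else p + 1) R M"

text \<open>Every instruction costs one step. The machine halts by leaving the program, and a halted machine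
  stays in its state.\<close>

definition halted :: "program \<Rightarrow> state \<Rightarrow> bool" where
  "halted P s \<longleftrightarrow> length P \<le> pc s"

definition step :: "nat \<Rightarrow> program \<Rightarrow> state \<Rightarrow> state" where
  "step w P s = (if halted P s then s else exec w (P ! pc s) s)"

text \<open>A data structure is a bit string, laid out in consecutive words of \<open>w\<close> bits, least significant
  bit first; the rest of the memory is zero.\<close>

definition mem_of_bits :: "nat \<Rightarrow> bool list \<Rightarrow> nat \<Rightarrow> nat" where
  "mem_of_bits w D k = horner_sum of_bool 2 (take w (drop (k * w) D))"

definition init :: "nat \<Rightarrow> bool list \<Rightarrow> nat \<Rightarrow> nat \<Rightarrow> state" where
  "init w D r c = State 0 ((\<lambda>_. 0)(0 := r, 1 := c)) (mem_of_bits w D)"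

text \<open>On input \<open>(r, c)\<close>, given in registers 0 and 1, the program halts within \<open>t\<close> steps with \<open>h\<close> in
  register 0. The memory ends up as it was, so that the data structure can be queried again.\<close>

definition answers :: "nat \<Rightarrow> program \<Rightarrow> bool list \<Rightarrow> nat \<Rightarrow> nat \<Rightarrow> nat \<Rightarrow> nat \<Rightarrow> bool" where
  "answers w P D r c t h \<longleftrightarrow>
     (let s = (step w P ^^ t) (init w D r c)
      in halted P s \<and> regs s 0 = h \<and> mem s = mem_of_bits w D)"

end

theory Submission
  imports Defs "HOL-Library.Discrete_Functions"
begin

text \<open>Let \<open>k = \<lfloor>log n\<rfloor>\<close> and \<open>J \<approx> log log n\<close>. The value \<open>q\<close> of \<open>g = A div (k J)\<close> is found exactly
  by descending a tree of square cells in which a cell of side \<open>2 ^ e\<close> is split into cells of side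
  \<open>2 ^ (e div 2)\<close>, unless \<open>g\<close> is constant on it; this takes \<open>O(log log n)\<close> steps. By monotonicity in both
  directions, \<open>g\<close> is non-constant on at most \<open>2 (n / s) (m / (k J))\<close> cells of side \<open>s\<close>, each of which
  has \<open>O(s)\<close> subcells, so the \<open>O(J)\<close> levels have \<open>O(n m / k)\<close> entries in total. Then \<open>A div k\<close> lies in
  \<open>q J, \<dots>, q J + J - 1\<close> and is found by linear search in a table which stores, for each row and each
  multiple of \<open>k\<close>, the column where the row reaches it; this table also has \<open>O(n m / k)\<close> entries. As an
  entry takes \<open>O(log n)\<close> bits, \<open>O(n m)\<close> bits suffice.

  The entries are packed in fields of \<open>b\<close> bits, \<open>Q\<close> to a word, with \<open>Q\<close> capped at the number of
  fields, as \<open>w\<close> may exceed \<open>n m\<close>.\<close>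

section \<open>Packed memory\<close>

lemma digit_sum:
  fixes f :: "nat \<Rightarrow> nat"
  assumes "\<And>j. f j < B"
  shows "(\<Sum>j<Q. f j * B ^ j) < B ^ Q"
    and "i < Q \<Longrightarrow> (\<Sum>j<Q. f j * B ^ j) div B ^ i mod B = f i"
proof -
  have *: "(\<Sum>j<Q. f j * B ^ j) < B ^ Q \<and> (\<forall>i<Q. (\<Sum>j<Q. f j * B ^ j) div B ^ i mod B = f i)"
    using assms
  proof (induction Q arbitrary: f)
    case 0
    then show ?case by simp
  next
    case (Suc Q)
    let ?S = "\<Sum>j<Q. f (Suc j) * B ^ j"
    have IH: "?S < B ^ Q" "\<And>i. i < Q \<Longrightarrow> ?S div B ^ i mod B = f (Suc i)"
      using Suc.IH[of "\<lambda>j. f (Suc j)"] Suc.prems by auto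
    \<comment> \<open>Splitting off the least significant digit leaves a digit sum of the shifted
      sequence, so the induction generalises \<open>f\<close>.\<close>
    have eq: "(\<Sum>j<Suc Q. f j * B ^ j) = f 0 + B * ?S"
      by (subst sum.lessThan_Suc_shift) (simp add: sum_distrib_left mult_ac)
    have f0: "f 0 < B" by (rule Suc.prems)
    have "B * (?S + 1) \<le> B * B ^ Q" using IH(1) by (intro mult_le_mono2) simp
    then have 1: "f 0 + B * ?S < B ^ Suc Q" using f0 by simp
    have "(f 0 + B * ?S) div B ^ i mod B = f i" if "i < Suc Q" for i
    proof (cases i)
      case 0
      then show ?thesis using f0 by simp
    next
      case (Suc k)
      then show ?thesis using f0 IH(2)[of k] that by (simp add: div_mult2_eq)
    qed
    then show ?case unfolding eq using 1 by blast
  qed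
  show "(\<Sum>j<Q. f j * B ^ j) < B ^ Q" using * by blast
  show "i < Q \<Longrightarrow> (\<Sum>j<Q. f j * B ^ j) div B ^ i mod B = f i" using * by blast
qed

text \<open>No field straddles a word boundary, so one \<open>Load\<close> retrieves it; positions
  past the end of \<open>fs\<close> are padded with 0.\<close>

definition packed :: "nat \<Rightarrow> nat \<Rightarrow> nat list \<Rightarrow> nat \<Rightarrow> nat" where
  "packed b Q fs t = (\<Sum>j<Q. (if t * Q + j < length fs then fs ! (t * Q + j) else 0) * (2 ^ b) ^ j)"

lemma packed_less:
  assumes "\<forall>x\<in>set fs. x < 2 ^ b"
  shows "packed b Q fs t < 2 ^ (b * Q)"
  unfolding packed_def power_mult by (rule digit_sum) (use assms in auto)

lemma packed_read:
  assumes "\<forall>x\<in>set fs. x < 2 ^ b" "i < length fs" "0 < Q"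
  shows "packed b Q fs (i div Q) div 2 ^ (i mod Q * b) mod 2 ^ b = fs ! i"
proof -
  have "packed b Q fs (i div Q) div (2 ^ b) ^ (i mod Q) mod 2 ^ b =
      (if i div Q * Q + i mod Q < length fs then fs ! (i div Q * Q + i mod Q) else 0)"
    unfolding packed_def by (rule digit_sum) (use assms in auto)
  then show ?thesis using assms by (simp add: power_mult mult.commute)
qed

lemma packed_header:
  assumes "\<forall>x\<in>set fs. x < 2 ^ b" "i < length fs" "i < Q"
  shows "packed b Q fs 0 div (2 ^ b) ^ i mod 2 ^ b = fs ! i"
  using packed_read[of fs b i Q] assms by (simp add: power_mult mult.commute)

lemma packed_beyond: "length fs \<le> t * Q \<Longrightarrow> packed b Q fs t = 0"
  by (simp add: packed_def)

section \<open>Bit strings realising a given memory\<close>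

lemma bit_less_exp:
  fixes x :: nat
  assumes "bit x j" "x < 2 ^ n"
  shows "j < n"
proof (rule ccontr)
  assume "\<not> j < n"
  then have "x div 2 ^ j = 0" using assms(2)
    by (meson div_less less_le_trans linorder_not_less one_le_numeral power_increasing)
  then show False using assms(1) by (simp add: bit_iff_odd)
qed

text \<open>No set bit lies at position \<open>L\<close> or beyond, so cutting the memory off after
  \<open>L\<close> bits loses nothing.\<close>

lemma mem_of_bits_ex:
  assumes "\<And>t. M t < 2 ^ w" and L: "\<And>t j. bit (M t) j \<Longrightarrow> t * w + j < L"
  shows "\<exists>D. length D = L \<and> mem_of_bits w D = M"
proof -
  define D where "D = map (\<lambda>p. bit (M (p div w)) (p mod w)) [0..<L]"
  have "mem_of_bits w D t = M t" for t
  proof (rule bit_eqI)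
    fix j
    have j: "j < w" if "bit (M t) j"
      using bit_less_exp[OF that assms(1)] .
    have "bit (mem_of_bits w D t) j \<longleftrightarrow> j < w \<and> t * w + j < L \<and> bit (M t) j"
      by (auto simp: mem_of_bits_def bit_horner_sum_bit_iff D_def min_def split: if_splits)
    then show "bit (mem_of_bits w D t) j \<longleftrightarrow> bit (M t) j"
      using j L by blast
  qed
  then show ?thesis by (intro exI[of _ D]) (auto simp: D_def)
qed

text \<open>If all fields fit into one word, \<open>b * length fs\<close> bits suffice however large
  \<open>w\<close> is. Otherwise \<open>w < (Q + 1) * b \<le> 2 * Q * b\<close>, so less than half
  of a word is wasted, and rounding up to whole words costs at most another factor of 2.\<close>

lemma packed_layout:
  assumes fs: "\<forall>x\<in>set fs. x < 2 ^ b" and b: "0 < b" and Q: "Q = min (w div b) (length fs)" "0 < Q"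
  shows "\<exists>D. length D \<le> 4 * b * length fs \<and> mem_of_bits w D = packed b Q fs"
proof -
  let ?N = "length fs"
  have "b * Q \<le> b * (w div b)" using Q by simp
  also have "\<dots> \<le> w" by simp
  finally have Qb: "b * Q \<le> w" .
  have less: "packed b Q fs t < 2 ^ w" for t
    using packed_less[OF fs, of Q t] Qb by (meson less_le_trans one_le_numeral power_increasing)
  show ?thesis
  proof (cases "?N \<le> w div b")
    case True
    then have QN: "Q = ?N" using Q by simp
    have "t * w + j < b * ?N" if "bit (packed b Q fs t) j" for t j
    proof (cases t)
      case 0
      then show ?thesis using bit_less_exp[OF that packed_less[OF fs]] QN by simp
    next
      case (Suc k)
      then have "packed b Q fs t = 0" using QN by (intro packed_beyond) simp
      then show ?thesis using that by simp
    qed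
    from mem_of_bits_ex[where M = "packed b Q fs", OF less this] obtain D where
      "length D = b * ?N" "mem_of_bits w D = packed b Q fs" by blast
    then show ?thesis by (intro exI[of _ D]) simp
  next
    case False
    then have QN: "Q = w div b" "Q < ?N" using Q by auto
    have "t * w + j < (?N div Q + 1) * w" if "bit (packed b Q fs t) j" for t j
    proof (cases "t \<le> ?N div Q")
      case True
      have "j < w" using bit_less_exp[OF that less] .
      then have "t * w + j < (t + 1) * w" by simp
      also have "\<dots> \<le> (?N div Q + 1) * w" using True by (intro mult_le_mono1) simp
      finally show ?thesis .
    next
      case False
      have "?N < (?N div Q + 1) * Q" using Q(2) by (metis Suc_eq_plus1 dividend_less_div_times mult.commute mult_Suc_right add.commute)
      also have "\<dots> \<le> t * Q" using False by (intro mult_le_mono1) simp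
      finally have "packed b Q fs t = 0" by (intro packed_beyond) simp
      then show ?thesis using that by simp
    qed
    from mem_of_bits_ex[where M = "packed b Q fs", OF less this] obtain D where D: "length D = (?N div Q + 1) * w" "mem_of_bits w D = packed b Q fs"
      by blast
    have "w < (Q + 1) * b" using QN b by (metis Suc_eq_plus1 dividend_less_div_times mult.commute mult_Suc_right add.commute)
    also have "\<dots> \<le> 2 * Q * b" using Q(2) by simp
    finally have "length D \<le> (?N div Q + 1) * (2 * Q * b)" unfolding D by (intro mult_le_mono2) simp
    also have "\<dots> = 2 * b * (?N div Q * Q + Q)" by (simp add: algebra_simps)
    also have "\<dots> \<le> 2 * b * (?N + ?N)" using QN by (intro mult_le_mono2 add_mono) auto
    also have "\<dots> = 4 * b * ?N" by simp
    finally show ?thesis using D(2) by blast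
  qed
qed

text \<open>Subtracting 1 flips exactly the lowest set bit, at position \<open>j\<close>, and the
  zeros below it, so the xor consists of \<open>j + 1\<close> ones.\<close>

lemma xor_pred_odd_multiple:
  "xor (2 ^ j * (2 * y + 1)) (2 ^ j * (2 * y + 1) - 1) + 1 = (2::nat) ^ (j + 1)"
proof (induction j)
  case 0
  show ?case by (simp add: xor_rec[of "Suc (2 * y)"])
next
  case (Suc j)
  let ?a = "2 ^ j * (2 * y + 1)"
  have "?a > 0" by simp
  then obtain k where k: "?a = Suc k" by (cases ?a) auto
  have "2 ^ Suc j * (2 * y + 1) = 2 * Suc k" "2 ^ Suc j * (2 * y + 1) - 1 = Suc (2 * k)"
    using k by auto
  then have "xor (2 ^ Suc j * (2 * y + 1)) (2 ^ Suc j * (2 * y + 1) - 1) = 1 + 2 * xor ?a (?a - 1)"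
    unfolding k by (subst xor_rec) (simp del: mult_Suc_right)
  then show ?case using Suc.IH by simp
qed

section \<open>Trees of square cells\<close>

text \<open>Concatenation of blocks of prescribed sizes. The addresses are chosen before the
  contents because the blocks of the tree contain addresses of one another.\<close>

lemma layout_ex:
  assumes "finite S"
  shows "\<exists>start :: 'b \<Rightarrow> nat. (\<forall>x\<in>S. start x \<le> sum sz S) \<and>
    (\<forall>content. (\<forall>x\<in>S. length (content x) = sz x) \<longrightarrow>
      (\<exists>L :: 'c list. length L = sum sz S \<and> set L \<subseteq> (\<Union>x\<in>S. set (content x)) \<and>
        (\<forall>x\<in>S. \<forall>j<sz x. start x + j < length L \<and> L ! (start x + j) = content x ! j)))"
  using assms
proof (induction S)
  case empty
  then show ?case by (intro exI[of _ "\<lambda>_. 0"]) auto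
next
  case (insert a S)
  from insert.IH obtain start where st: "(\<forall>x\<in>S. start x \<le> sum sz S) \<and>
    (\<forall>content. (\<forall>x\<in>S. length (content x) = sz x) \<longrightarrow>
      (\<exists>L :: 'c list. length L = sum sz S \<and> set L \<subseteq> (\<Union>x\<in>S. set (content x)) \<and>
        (\<forall>x\<in>S. \<forall>j<sz x. start x + j < length L \<and> L ! (start x + j) = content x ! j)))"
    by (rule exE)
  have sum: "sum sz (insert a S) = sum sz S + sz a" using insert by simp
  show ?case
  proof (intro exI[of _ "start(a := sum sz S)"] conjI allI impI)
    show "\<forall>x\<in>insert a S. (start(a := sum sz S)) x \<le> sum sz (insert a S)"
      using conjunct1[OF st] sum by (auto simp: trans_le_add1)
    fix content :: "'b \<Rightarrow> 'c list" assume c: "\<forall>x\<in>insert a S. length (content x) = sz x"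
    then have "\<forall>x\<in>S. length (content x) = sz x" by simp
    from mp[OF spec[where x = content, OF conjunct2[OF st]] this] obtain L where
      L: "length L = sum sz S" "set L \<subseteq> (\<Union>x\<in>S. set (content x))"
      "\<forall>x\<in>S. \<forall>j<sz x. start x + j < length L \<and> L ! (start x + j) = content x ! j"
      by (elim exE conjE)
    show "\<exists>L. length L = sum sz (insert a S) \<and> set L \<subseteq> (\<Union>x\<in>insert a S. set (content x)) \<and>
        (\<forall>x\<in>insert a S. \<forall>j<sz x. (start(a := sum sz S)) x + j < length L \<and>
          L ! ((start(a := sum sz S)) x + j) = content x ! j)"
    proof (intro exI[of _ "L @ content a"] conjI ballI allI impI)
      show "length (L @ content a) = sum sz (insert a S)" using L c sum by simp
      show "set (L @ content a) \<subseteq> (\<Union>x\<in>insert a S. set (content x))" using L by auto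
      fix x j assume "x \<in> insert a S" "j < sz x"
      then show "(start(a := sum sz S)) x + j < length (L @ content a)"
        "(L @ content a) ! ((start(a := sum sz S)) x + j) = content x ! j"
        using L c insert.hyps by (auto simp: nth_append trans_less_add1)
    qed
  qed
qed

text \<open>The exponents at which the descent can meet an active cell; 0 is excluded because a cell
  of side 1 is never active.\<close>

definition levels :: "nat \<Rightarrow> nat set" where
  "levels e0 = {e. 0 < e \<and> (\<exists>i. e = e0 div 2 ^ i)}"

lemma levels_card:
  assumes "e0 < 2 ^ J"
  shows "finite (levels e0)" "card (levels e0) \<le> J"
proof -
  have sub: "levels e0 \<subseteq> (\<lambda>i. e0 div 2 ^ i) ` {..<J}"
  proof
    fix e assume "e \<in> levels e0"
    then obtain i where i: "0 < e0 div 2 ^ i" "e = e0 div 2 ^ i" by (auto simp: levels_def)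
    have "i < J"
    proof (rule ccontr)
      assume "\<not> i < J"
      then have "(2::nat) ^ J \<le> 2 ^ i" by simp
      then show False using assms i by (metis div_less less_le_trans less_irrefl)
    qed
    then show "e \<in> (\<lambda>i. e0 div 2 ^ i) ` {..<J}" using i by blast
  qed
  show "finite (levels e0)" by (rule finite_subset[OF sub]) simp
  have "card (levels e0) \<le> card ((\<lambda>i. e0 div 2 ^ i) ` {..<J})" by (rule card_mono[OF _ sub]) simp
  also have "\<dots> \<le> J" using card_image_le[of "{..<J}"] by simp
  finally show "card (levels e0) \<le> J" .
qed

text \<open>\<open>g\<close> is total because the grid of cells has a power of two as its side and
  may extend beyond the array.\<close>

locale monotone_grid =
  fixes g :: "nat \<Rightarrow> nat \<Rightarrow> nat" and gmax :: nat
  assumes mono: "r \<le> r' \<Longrightarrow> c \<le> c' \<Longrightarrow> g r c \<le> g r' c'"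
    and gmax: "g r c \<le> gmax"
begin

text \<open>A cell of side \<open>2 ^ e\<close> is active if \<open>g\<close> is not constant on it; by monotonicity it suffices to
  compare two opposite corners.\<close>

definition active :: "nat \<Rightarrow> nat \<Rightarrow> nat \<Rightarrow> bool" where
  "active e R C \<longleftrightarrow> g (R * 2 ^ e) (C * 2 ^ e) < g (R * 2 ^ e + 2 ^ e - 1) (C * 2 ^ e + 2 ^ e - 1)"

lemma inactive_const:
  assumes "\<not> active e (r div 2 ^ e) (c div 2 ^ e)"
  shows "g (r div 2 ^ e * 2 ^ e) (c div 2 ^ e * 2 ^ e) = g r c"
proof (rule antisym)
  show "g (r div 2 ^ e * 2 ^ e) (c div 2 ^ e * 2 ^ e) \<le> g r c"
    by (intro mono) simp_all
  have *: "x \<le> x div 2 ^ e * 2 ^ e + 2 ^ e - 1" for x :: nat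
  proof -
    have "x mod 2 ^ e < 2 ^ e" by simp
    moreover have "x = x div 2 ^ e * 2 ^ e + x mod 2 ^ e" by (simp only: div_mult_mod_eq)
    ultimately show ?thesis by linarith
  qed
  have "g r c \<le> g (r div 2 ^ e * 2 ^ e + 2 ^ e - 1) (c div 2 ^ e * 2 ^ e + 2 ^ e - 1)"
    by (intro mono *)
  then show "g r c \<le> g (r div 2 ^ e * 2 ^ e) (c div 2 ^ e * 2 ^ e)"
    using assms unfolding active_def by linarith
qed

lemma not_active_0: "\<not> active 0 R C"
  by (simp add: active_def)

section \<open>Counting active cells\<close>

definition cells :: "nat \<Rightarrow> nat \<Rightarrow> (nat \<times> nat) set" where
  "cells e G = {(R, C). R < G \<and> C < G \<and> active e R C}"

lemma cells_subset: "cells e G \<subseteq> {..<G} \<times> {..<G}"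
  by (auto simp: cells_def)

lemma finite_cells: "finite (cells e G)"
  by (rule finite_subset[OF cells_subset]) simp

lemma card_cells_le_area: "card (cells e G) \<le> G * G"
  using card_mono[OF _ cells_subset[of e G]] by simp

text \<open>An active cell contributes at least 1 to the sum of the differences between the values of \<open>g\<close> at
  \<open>(R + 1, C + 1)\<close> and \<open>(R, C)\<close>, in units of \<open>2 ^ e\<close>; this sum telescopes to the boundary of the grid.\<close>

lemma card_cells_le_boundary: "card (cells e G) \<le> 2 * G * gmax"
proof -
  let ?H = "\<lambda>R C. int (g (R * 2 ^ e) (C * 2 ^ e))"
  have H0: "0 \<le> ?H (Suc R) (Suc C) - ?H R C" for R C
    by (simp add: mono)
  have H1: "1 \<le> ?H (Suc R) (Suc C) - ?H R C" if "active e R C" for R C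
  proof -
    have "g (R * 2 ^ e + 2 ^ e - 1) (C * 2 ^ e + 2 ^ e - 1) \<le> g (Suc R * 2 ^ e) (Suc C * 2 ^ e)"
      by (intro mono) auto
    then show ?thesis using that unfolding active_def by linarith
  qed
  have tel: "(\<Sum>i<G. f (Suc i) - f i) \<le> int gmax" if "\<And>i. 0 \<le> f i" "\<And>i. f i \<le> int gmax" for f :: "nat \<Rightarrow> int"
    using sum_lessThan_telescope[of f G] that[of 0] that[of G] by linarith
  have "int (card (cells e G)) = (\<Sum>(R,C)\<in>cells e G. 1)" by simp
  also have "\<dots> \<le> (\<Sum>(R,C)\<in>cells e G. ?H (Suc R) (Suc C) - ?H R C)"
    by (rule sum_mono) (use H1 in \<open>auto simp: cells_def\<close>)
  also have "\<dots> \<le> (\<Sum>(R,C)\<in>{..<G} \<times> {..<G}. ?H (Suc R) (Suc C) - ?H R C)"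
    by (rule sum_mono2) (use cells_subset H0 in auto)
  \<comment> \<open>Each diagonal difference splits into a step in \<open>R\<close>, which
    telescopes for fixed \<open>C\<close>, and a step in \<open>C\<close>, which telescopes for
    fixed \<open>R\<close>.\<close>
  also have "\<dots> = (\<Sum>R<G. \<Sum>C<G. (?H (Suc R) (Suc C) - ?H R (Suc C)) + (?H R (Suc C) - ?H R C))"
    by (subst sum.cartesian_product[symmetric]) simp
  also have "\<dots> = (\<Sum>R<G. \<Sum>C<G. ?H (Suc R) (Suc C) - ?H R (Suc C)) + (\<Sum>R<G. \<Sum>C<G. ?H R (Suc C) - ?H R C)"
    by (simp only: sum.distrib)
  also have "(\<Sum>R<G. \<Sum>C<G. ?H (Suc R) (Suc C) - ?H R (Suc C)) = (\<Sum>C<G. \<Sum>R<G. ?H (Suc R) (Suc C) - ?H R (Suc C))"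
    by (rule sum.swap)
  also have "\<dots> \<le> (\<Sum>C<G. int gmax)"
    by (rule sum_mono, rule tel) (use gmax in auto)
  also have "(\<Sum>R<G. \<Sum>C<G. ?H R (Suc C) - ?H R C) \<le> (\<Sum>R<G. int gmax)"
    by (rule sum_mono, rule tel) (use gmax in auto)
  finally have "int (card (cells e G)) \<le> int (2 * G * gmax)" by simp
  then show ?thesis by linarith
qed

text \<open>Block size times the number of active cells is at most \<open>4 * 2 ^ e0 * gmax\<close>
  per level by the boundary bound and at most \<open>2 * 4 ^ e0\<close> by the area bound; there are
  at most \<open>J\<close> levels. The second estimate is the useful one when \<open>gmax\<close> is
  large.\<close>

lemma quadtree_size:
  assumes "e0 < 2 ^ J"
  shows "finite (Sigma (levels e0) (\<lambda>e. cells e (2 ^ (e0 - e))))" (is "finite ?S")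
    and "(\<Sum>(e, RC)\<in>Sigma (levels e0) (\<lambda>e. cells e (2 ^ (e0 - e))). 4 ^ (e - e div 2)) \<le> 4 * J * 2 ^ e0 * gmax"
    and "(\<Sum>(e, RC)\<in>Sigma (levels e0) (\<lambda>e. cells e (2 ^ (e0 - e))). 4 ^ (e - e div 2)) \<le> 2 * J * 4 ^ e0"
proof -
  let ?G = "\<lambda>e. (2::nat) ^ (e0 - e)"
  show "finite ?S" using levels_card[OF assms] finite_cells by auto
  have lev: "e \<le> e0" if "e \<in> levels e0" for e using that by (auto simp: levels_def)
  \<comment> \<open>The binary exponent is \<open>2 * (e - e div 2) \<le> e + 1\<close>; the
    rounding for odd \<open>e\<close> costs the factor 2.\<close>
  have sz: "(4::nat) ^ (e - e div 2) \<le> 2 * 2 ^ e" for e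
  proof -
    have "(4::nat) ^ (e - e div 2) = 2 ^ (2 * (e - e div 2))" by (simp add: power_mult)
    also have "\<dots> \<le> 2 ^ Suc e" by (rule power_increasing) auto
    finally show ?thesis by simp
  qed
  have GG: "?G e * 2 ^ e = 2 ^ e0" if "e \<in> levels e0" for e
    using lev[OF that] by (simp add: power_add[symmetric])
  have eq: "(\<Sum>(e, RC)\<in>?S. 4 ^ (e - e div 2)) = (\<Sum>e\<in>levels e0. card (cells e (?G e)) * 4 ^ (e - e div 2))"
    using levels_card[OF assms] finite_cells by (subst sum.Sigma[symmetric]) auto
  have "card (cells e (?G e)) * 4 ^ (e - e div 2) \<le> 4 * 2 ^ e0 * gmax" if "e \<in> levels e0" for e
  proof -
    have "card (cells e (?G e)) * 4 ^ (e - e div 2) \<le> (2 * ?G e * gmax) * (2 * 2 ^ e)"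
      by (intro mult_le_mono card_cells_le_boundary sz)
    also have "\<dots> = 4 * (?G e * 2 ^ e) * gmax" by simp
    finally show ?thesis unfolding GG[OF that] .
  qed
  then have "(\<Sum>e\<in>levels e0. card (cells e (?G e)) * 4 ^ (e - e div 2)) \<le> card (levels e0) * (4 * 2 ^ e0 * gmax)"
    using sum_bounded_above[of "levels e0" _ "4 * 2 ^ e0 * gmax :: nat"] by simp
  also have "\<dots> \<le> J * (4 * 2 ^ e0 * gmax)" using levels_card[OF assms] by (intro mult_le_mono1)
  finally show "(\<Sum>(e, RC)\<in>?S. 4 ^ (e - e div 2)) \<le> 4 * J * 2 ^ e0 * gmax" unfolding eq by (simp add: mult_ac)
  have "card (cells e (?G e)) * 4 ^ (e - e div 2) \<le> 2 * 4 ^ e0" if "e \<in> levels e0" for e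
  proof -
    have "card (cells e (?G e)) * 4 ^ (e - e div 2) \<le> (?G e * ?G e) * (2 * 2 ^ e)"
      by (intro mult_le_mono card_cells_le_area sz)
    also have "\<dots> = 2 * ?G e * (?G e * 2 ^ e)" by simp
    also have "\<dots> \<le> 2 * 2 ^ e0 * 2 ^ e0" unfolding GG[OF that] by (intro mult_le_mono) (auto intro: power_increasing)
    also have "\<dots> = 2 * 4 ^ e0" by (simp add: power_mult_distrib[symmetric] mult.assoc)
    finally show ?thesis .
  qed
  then have "(\<Sum>e\<in>levels e0. card (cells e (?G e)) * 4 ^ (e - e div 2)) \<le> card (levels e0) * (2 * 4 ^ e0)"
    using sum_bounded_above[of "levels e0" _ "2 * 4 ^ e0 :: nat"] by simp
  also have "\<dots> \<le> J * (2 * 4 ^ e0)" using levels_card[OF assms] by (intro mult_le_mono1)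
  finally show "(\<Sum>(e, RC)\<in>?S. 4 ^ (e - e div 2)) \<le> 2 * J * 4 ^ e0" unfolding eq by (simp add: mult_ac)
qed

text \<open>The table entry of a cell is odd for an inactive cell and then carries the value of \<open>g\<close> there; it
  is even for an active cell and then carries the address of the block of its subcells of side
  \<open>2 ^ (e div 2)\<close>, in row-major order. Cells of side 1 are inactive, so the descent ends.\<close>

lemma quadtree_ex:
  assumes e0: "e0 < 2 ^ J"
  shows "\<exists>(L :: nat list) ent.
    length L \<le> 4 * J * 2 ^ e0 * gmax \<and> length L \<le> 2 * J * 4 ^ e0 \<and>
    (\<forall>x \<in> insert (ent e0 0 0) (set L). x \<le> 2 * (off + length L + gmax) + 1) \<and>
    (\<forall>i r c. r < 2 ^ e0 \<and> c < 2 ^ e0 \<longrightarrow>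
      (let e = e0 div 2 ^ i; x = ent e (r div 2 ^ e) (c div 2 ^ e); p = 2 ^ (e - e div 2);
           idx = x div 2 + r div 2 ^ (e div 2) mod p * p + c div 2 ^ (e div 2) mod p
       in if odd x then x div 2 = g r c
          else 0 < e \<and> off \<le> idx \<and> idx < off + length L \<and>
            L ! (idx - off) = ent (e div 2) (r div 2 ^ (e div 2)) (c div 2 ^ (e div 2))))"
proof -
  let ?S = "Sigma (levels e0) (\<lambda>e. cells e (2 ^ (e0 - e)))"
  define sz :: "nat \<times> nat \<times> nat \<Rightarrow> nat" where "sz = (\<lambda>(e, RC). 4 ^ (e - e div 2))"
  from layout_ex[OF quadtree_size(1)[OF e0], of sz] obtain start where
    start: "(\<forall>x\<in>?S. start x \<le> sum sz ?S) \<and>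
    (\<forall>content. (\<forall>x\<in>?S. length (content x) = sz x) \<longrightarrow>
      (\<exists>L :: nat list. length L = sum sz ?S \<and> set L \<subseteq> (\<Union>x\<in>?S. set (content x)) \<and>
        (\<forall>x\<in>?S. \<forall>j<sz x. start x + j < length L \<and> L ! (start x + j) = content x ! j)))"
    by (rule exE)
  define ent where "ent e R C = (if active e R C then 2 * (off + start (e, R, C))
     else 2 * g (R * 2 ^ e) (C * 2 ^ e) + 1)" for e R C
  define content where "content = (\<lambda>(e, R, C). let d = e - e div 2 in
     map (\<lambda>j. ent (e div 2) (R * 2 ^ d + j div 2 ^ d) (C * 2 ^ d + j mod 2 ^ d)) [0..<4 ^ d])"
  have "\<forall>x\<in>?S. length (content x) = sz x" by (auto simp: content_def sz_def Let_def)
  from mp[OF spec[where x = content, OF conjunct2[OF start]] this] obtain L where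
    L: "length L = sum sz ?S" "set L \<subseteq> (\<Union>x\<in>?S. set (content x))"
    "\<forall>x\<in>?S. \<forall>j<sz x. start x + j < length L \<and> L ! (start x + j) = content x ! j"
    by (elim exE conjE)
  have split: "x div 2 ^ (e div 2) = x div 2 ^ e * 2 ^ (e - e div 2) + x div 2 ^ (e div 2) mod 2 ^ (e - e div 2)"
    for x e :: nat
  proof -
    have "(2::nat) ^ e = 2 ^ (e div 2) * 2 ^ (e - e div 2)" by (simp add: power_add[symmetric])
    then have "x div 2 ^ e = x div 2 ^ (e div 2) div 2 ^ (e - e div 2)" by (simp add: div_mult2_eq)
    then show ?thesis by (simp only: div_mult_mod_eq)
  qed
  \<comment> \<open>Every active cell met in the descent owns a block, since activity rules out
    exponent 0.\<close>
  have inS: "(e, r, c) \<in> ?S" if "active e r c" "e = e0 div 2 ^ i" "r < 2 ^ (e0 - e)" "c < 2 ^ (e0 - e)" for e i r c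
    using that not_active_0 by (cases "e = 0") (auto simp: levels_def cells_def)
  have ent_le: "ent e R C \<le> 2 * (off + length L + gmax) + 1" if "e = e0 div 2 ^ i" "R < 2 ^ (e0 - e)" "C < 2 ^ (e0 - e)" for e i R C
  proof (cases "active e R C")
    case True
    then have "start (e, R, C) \<le> length L" using bspec[OF conjunct1[OF start] inS[OF True that]] L(1) by simp
    then show ?thesis using True by (simp add: ent_def)
  next
    case False
    then show ?thesis using gmax[of "R * 2 ^ e" "C * 2 ^ e"] by (simp add: ent_def)
  qed
  have child_lt: "R * 2 ^ (e - e div 2) + j < 2 ^ (e0 - e div 2)"
    if "R < 2 ^ (e0 - e)" "j < 2 ^ (e - e div 2)" "e \<le> e0" for R e j :: nat
  proof -
    have "R * 2 ^ (e - e div 2) + j < (R + 1) * 2 ^ (e - e div 2)" using that by simp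
    also have "\<dots> \<le> 2 ^ (e0 - e) * 2 ^ (e - e div 2)" using that by (intro mult_le_mono1) simp
    also have "\<dots> = 2 ^ (e0 - e div 2)" using that(3) by (simp add: power_add[symmetric])
    finally show ?thesis .
  qed
  show ?thesis
  proof (intro exI[of _ L] exI[of _ ent] conjI allI impI ballI)
    show "length L \<le> 4 * J * 2 ^ e0 * gmax" "length L \<le> 2 * J * 4 ^ e0"
      using quadtree_size(2,3)[OF e0] unfolding L(1) sz_def by auto
  next
    fix x assume "x \<in> insert (ent e0 0 0) (set L)"
    then consider "x = ent e0 0 0" | "x \<in> set L" by blast
    then show "x \<le> 2 * (off + length L + gmax) + 1"
    proof cases
      case 1
      then show ?thesis using ent_le[of e0 0 0 0] by simp
    next
      case 2
      then obtain e R C where eRC: "(e, R, C) \<in> ?S" "x \<in> set (content (e, R, C))" using L(2) by fast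
      let ?d = "e - e div 2"
      obtain j where j: "j < 4 ^ ?d" "x = ent (e div 2) (R * 2 ^ ?d + j div 2 ^ ?d) (C * 2 ^ ?d + j mod 2 ^ ?d)"
        using eRC(2) by (auto simp: content_def Let_def)
      obtain i where i: "e = e0 div 2 ^ i" using eRC(1) by (auto simp: levels_def)
      have "j div 2 ^ ?d < 2 ^ ?d" using j(1)
        by (metis less_mult_imp_div_less mult_2 num_double numeral_times_numeral power_mult_distrib)
      moreover have "e \<le> e0" using i by simp
      ultimately show ?thesis
        unfolding j(2) using eRC(1) i
        by (intro ent_le[of _ "Suc i"] child_lt) (auto simp: cells_def div_mult2_eq[symmetric] mult.commute)
    qed
  next
    fix i r c :: nat assume rc: "r < 2 ^ e0 \<and> c < 2 ^ e0"
    define e where "e = e0 div 2 ^ i"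
    define R C where "R = r div 2 ^ e" and "C = c div 2 ^ e"
    define p where "p = (2::nat) ^ (e - e div 2)"
    define X Y where "X = r div 2 ^ (e div 2) mod p" and "Y = c div 2 ^ (e div 2) mod p"
    define x where "x = ent e R C"
    have ee0: "e \<le> e0" by (simp add: e_def)
    have "(2::nat) ^ e0 = 2 ^ (e0 - e) * 2 ^ e" using ee0 by (simp add: power_add[symmetric])
    then have RC: "R < 2 ^ (e0 - e)" "C < 2 ^ (e0 - e)"
      using rc unfolding R_def C_def by (auto intro: less_mult_imp_div_less)
    have "if odd x then x div 2 = g r c
          else 0 < e \<and> off \<le> x div 2 + X * p + Y \<and> x div 2 + X * p + Y < off + length L \<and>
            L ! (x div 2 + X * p + Y - off) = ent (e div 2) (r div 2 ^ (e div 2)) (c div 2 ^ (e div 2))"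
    proof (cases "active e R C")
      case False
      then show ?thesis using inactive_const[of e r c] by (simp add: x_def ent_def R_def C_def)
    next
      case True
      have S: "(e, R, C) \<in> ?S" using inS[OF True e_def RC] .
      have XY: "X < p" "Y < p" unfolding X_def Y_def by (simp_all add: p_def)
      have "X * p + Y < (X + 1) * p" using XY by simp
      also have "\<dots> \<le> p * p" using XY by (intro mult_le_mono1) simp
      finally have j: "X * p + Y < p * p" .
      have pp: "p * p = 4 ^ (e - e div 2)" unfolding p_def by (simp add: power_mult_distrib[symmetric])
      have "X * p + Y < sz (e, R, C)" using j pp by (simp add: sz_def)
      from bspec[OF L(3) S, rule_format, OF this] have idx: "start (e, R, C) + (X * p + Y) < length L"
        and val: "L ! (start (e, R, C) + (X * p + Y)) = content (e, R, C) ! (X * p + Y)" by auto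
      have dm: "(X * p + Y) div p = X" "(X * p + Y) mod p = Y" using XY by auto
      have "content (e, R, C) ! (X * p + Y) = ent (e div 2) (R * p + X) (C * p + Y)"
        using j unfolding pp content_def by (simp add: Let_def p_def[symmetric] dm XY)
      also have "\<dots> = ent (e div 2) (r div 2 ^ (e div 2)) (c div 2 ^ (e div 2))"
        using split[of r e] split[of c e] by (simp add: R_def C_def X_def Y_def p_def)
      finally show ?thesis using True idx val not_active_0
        by (cases "e = 0") (auto simp: x_def ent_def add.assoc)
    qed
    then show "let e = e0 div 2 ^ i; x = ent e (r div 2 ^ e) (c div 2 ^ e); p = 2 ^ (e - e div 2);
           idx = x div 2 + r div 2 ^ (e div 2) mod p * p + c div 2 ^ (e div 2) mod p
       in if odd x then x div 2 = g r c
          else 0 < e \<and> off \<le> idx \<and> idx < off + length L \<and>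
            L ! (idx - off) = ent (e div 2) (r div 2 ^ (e div 2)) (c div 2 ^ (e div 2))"
      unfolding Let_def e_def x_def R_def C_def X_def Y_def p_def .
  qed
qed

end

section \<open>The query program\<close>

text \<open>Registers: 0 and 1 hold \<open>r\<close> and \<open>c\<close>; 3 and 12 hold the constants 1 and 2; 4 to 9 hold \<open>2 ^ b\<close>,
  \<open>b\<close>, \<open>Q\<close>, \<open>imax\<close>, \<open>J\<close>, \<open>k\<close>; 10 is the exponent of the current cell side; 11 is the current tree
  entry, later the scanning index; 2 and 13 to 15 are scratch. The program initialises itself up to
  address 19, descends the tree at 20 to 42, scans at 43 to 57 and outputs at 58 to 60. The width \<open>b\<close> is
  bootstrapped from field 0, which contains \<open>2 ^ (b - 1)\<close>: for the first memory word \<open>x\<close> one then has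
  \<open>xor x (x - 1) + 1 = 2 ^ b\<close>.\<close>

definition prog :: program where
  "prog = [
     Load 2 2, Const 3 1, Op Sub 4 2 3, Op Xor 4 2 4, Op Add 4 4 3,
     Op Div 2 2 4, Op Mod 5 2 4,
     Op Div 2 2 4, Op Mod 6 2 4,
     Op Div 2 2 4, Op Mod 7 2 4,
     Op Div 2 2 4, Op Mod 8 2 4,
     Op Div 2 2 4, Op Mod 9 2 4,
     Op Div 2 2 4, Op Mod 10 2 4,
     Op Div 2 2 4, Op Mod 11 2 4,
     Const 12 2,
     Op Mod 2 11 12, JumpEq 2 3 41,
     Op Div 11 11 12, Op Div 13 10 12, Op Sub 14 10 13, Op Shl 14 3 14,
     Op Shr 15 0 13, Op Mod 15 15 14, Op Mul 15 15 14, Op Add 11 11 15,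
     Op Shr 15 1 13, Op Mod 15 15 14, Op Add 11 11 15,
     Op Div 15 11 6, Op Mod 14 11 6, Op Mul 14 14 5, Load 15 15, Op Shr 15 15 14, Op Mod 11 15 4,
     Op Div 10 10 12, Jump 20,
     Op Div 11 11 12, Op Mul 11 11 8,
     JumpLess 11 7 45, Jump 58,
     Op Mul 2 0 7, Op Add 2 2 11, Const 15 8, Op Add 2 2 15,
     Op Div 15 2 6, Op Mod 14 2 6, Op Mul 14 14 5, Load 15 15, Op Shr 15 15 14, Op Mod 2 15 4,
     JumpLess 1 2 58, Op Add 11 11 3, Jump 43,
     Op Mul 0 11 9, Op Add 0 0 9, Op Sub 0 0 3]"

section \<open>Symbolic execution of the program\<close>

lemma length_prog: "length prog = 61" by (simp add: prog_def)

lemma step_prog: "p < 61 \<Longrightarrow> step w prog (State p R M) = exec w (prog ! p) (State p R M)"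
  by (simp add: step_def halted_def length_prog)

lemma run_numeral:
  "(step w P ^^ numeral v) s = (step w P ^^ pred_numeral v) (step w P s)"
  by (simp add: numeral_eq_Suc funpow_swap1)

lemma run_Suc: "(step w P ^^ Suc t) s = (step w P ^^ t) (step w P s)"
  by (simp add: funpow_swap1)

lemma sub_no_borrow: "b \<le> a \<Longrightarrow> a < 2 ^ w \<Longrightarrow> (2 ^ w + a - b) mod 2 ^ w = (a - b :: nat)"
  by (metis Nat.add_diff_assoc less_imp_diff_less mod_add_self1 mod_less)

lemma run_1: "(step w P ^^ 1) s = step w P s"
  by simp

text \<open>The code is unfolded only where an instruction is fetched, so \<open>step w prog\<close>
  stays folded during the execution.\<close>

lemmas nth_prog = arg_cong[OF prog_def, of "\<lambda>P. P ! p" for p]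
lemmas exec_simps = run_numeral run_Suc run_1 step_prog nth_prog

text \<open>Register 2 starts as 0 so that the first \<open>Load\<close> fetches word 0.
  \<open>B\<close> stands for \<open>2 ^ b\<close>; field \<open>i\<close> appears after
  \<open>i\<close> divisions by \<open>B\<close>.\<close>

lemma run_init:
  assumes x: "M 0 = x" and R: "R 2 = 0" and w: "(2::nat) < 2 ^ w"
    and x1: "1 \<le> x" "x < 2 ^ w" and B: "xor x (x - 1) + 1 = B" "B < 2 ^ w"
  shows "\<exists>R'. (step w prog ^^ 20) (State 0 R M) = State 20 R' M \<and>
     R' 0 = R 0 \<and> R' 1 = R 1 \<and> R' 3 = 1 \<and> R' 4 = B \<and>
     R' 5 = x div B mod B \<and> R' 6 = x div B ^ 2 mod B \<and> R' 7 = x div B ^ 3 mod B \<and>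
     R' 8 = x div B ^ 4 mod B \<and> R' 9 = x div B ^ 5 mod B \<and> R' 10 = x div B ^ 6 mod B \<and>
     R' 11 = x div B ^ 7 mod B \<and> R' 12 = 2"
proof -
  have w': "1 < (2::nat) ^ w" using w by linarith
  note s = sub_no_borrow[OF x1] mod_less[OF w] mod_less[OF w']
  have B': "Suc (xor x (x - 1)) = B" using B by simp
  show ?thesis
    by (simp add: exec_simps x R s[simplified] B B' B'[simplified] power_numeral_reduce div_mult2_eq mult.commute del: One_nat_def)
qed

lemma run_descend:
  assumes R: "R 0 = r" "R 1 = c" "R 3 = 1" "R 4 = B" "R 5 = b" "R 6 = Q" "R 10 = e" "R 11 = E" "R 12 = 2"
    and E: "even E" and p: "p = 2 ^ (e - e div 2)"
    and idx: "idx = E div 2 + r div 2 ^ (e div 2) mod p * p + c div 2 ^ (e div 2) mod p"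
    and ov: "idx < 2 ^ w" "idx mod Q * b < 2 ^ w" "p < 2 ^ w" "e < 2 ^ w"
    and v: "M (idx div Q) div 2 ^ (idx mod Q * b) mod B = v"
  shows "\<exists>R'. (step w prog ^^ 21) (State 20 R M) = State 20 R' M \<and>
    (\<forall>i\<in>{0,1,3,4,5,6,7,8,9,12}. R' i = R i) \<and> R' 10 = e div 2 \<and> R' 11 = v"
proof -
  let ?X = "r div 2 ^ (e div 2) mod p" and ?Y = "c div 2 ^ (e div 2) mod p"
  have 1: "(2 ^ w + e - e div 2) mod 2 ^ w = e - e div 2" using ov by (intro sub_no_borrow) auto
  \<comment> \<open>The partial sums are bounded by \<open>idx\<close>, so the bound on
    \<open>idx\<close> excludes wrap-around in all of them.\<close>
  have "?X * p \<le> idx" "E div 2 + ?X * p \<le> idx" using idx by auto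
  with ov have 2: "?X * p mod 2 ^ w = ?X * p" "(E div 2 + ?X * p) mod 2 ^ w = E div 2 + ?X * p"
    by auto
  have 3: "2 ^ (e - e div 2) mod 2 ^ w = p" using ov p by simp
  have 4: "(E div 2 + ?X * p + ?Y) mod 2 ^ w = idx" using ov idx by simp
  show ?thesis
    by (simp add: exec_simps R E 1 2 3 4 v ov del: One_nat_def)
qed

text \<open>The leaf value counts multiples of \<open>k * J\<close>, the scan counts multiples of
  \<open>k\<close>; hence the factor \<open>J\<close>.\<close>

lemma run_leaf:
  assumes R: "R 3 = 1" "R 8 = J" "R 11 = E" "R 12 = 2" and E: "odd E"
    and ov: "E div 2 * J < 2 ^ w"
  shows "\<exists>R'. (step w prog ^^ 4) (State 20 R M) = State 43 R' M \<and>
    (\<forall>i\<in>{0,1,3,4,5,6,7,8,9,12}. R' i = R i) \<and> R' 11 = E div 2 * J"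
  by (use E in \<open>simp add: exec_simps R ov odd_iff_mod_2_eq_one del: One_nat_def\<close>)

lemma run_scan_end:
  assumes R: "R 7 = imax" "R 11 = i" and i: "\<not> i < imax"
  shows "(step w prog ^^ 2) (State 43 R M) = State 58 R M"
  using i by (simp add: exec_simps R)

text \<open>One pass through the scan. An entry \<open>v\<close> above \<open>c\<close> means that
  the row has not reached the next multiple of \<open>k\<close> at column \<open>c\<close>, so the
  scan exits.\<close>

lemma run_scan:
  assumes R: "R 0 = r" "R 1 = c" "R 3 = 1" "R 4 = B" "R 5 = b" "R 6 = Q" "R 7 = imax" "R 11 = i"
    and i: "i < imax" and idx: "idx = r * imax + i + 8"
    and ov: "idx < 2 ^ w" "idx mod Q * b < 2 ^ w"
    and v: "M (idx div Q) div 2 ^ (idx mod Q * b) mod B = v"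
  shows "\<exists>R'. (step w prog ^^ (if c < v then 12 else 14)) (State 43 R M) = State (if c < v then 58 else 43) R' M \<and>
    (\<forall>j\<in>{0,1,3,4,5,6,7,8,9,12}. R' j = R j) \<and> R' 11 = (if c < v then i else i + 1)"
proof -
  have 1: "r * imax mod 2 ^ w = r * imax" "(r * imax + i) mod 2 ^ w = r * imax + i" "8 mod 2 ^ w = (8::nat)"
      "(r * imax + i + 8) mod 2 ^ w = idx"
    using ov idx by (auto)
  have "i < idx" using idx by simp
  then have 2: "(i + 1) mod 2 ^ w = i + 1" using ov by simp
  show ?thesis
  proof (cases "c < v")
    case True
    then show ?thesis
      by (simp add: exec_simps R 1 2 v ov i del: One_nat_def)
  next
    case False
    then show ?thesis
      by (simp add: exec_simps R 1 2 v ov i del: One_nat_def)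
  qed
qed

lemma run_output:
  assumes R: "R 3 = 1" "R 9 = k" "R 11 = i" and k: "1 \<le> k" and ov: "i * k + k < 2 ^ w"
  shows "\<exists>R'. (step w prog ^^ 3) (State 58 R M) = State 61 R' M \<and> R' 0 = i * k + k - 1"
proof -
  have 1: "i * k mod 2 ^ w = i * k" "(i * k + k) mod 2 ^ w = i * k + k"
    "(2 ^ w + (i * k + k) - 1) mod 2 ^ w = i * k + k - 1"
    using ov k by (auto intro!: sub_no_borrow[of 1, simplified])
  show ?thesis
    by (simp add: exec_simps R 1[simplified])
qed

section \<open>Composing runs into a full query\<close>

lemma run_trans:
  "(step w P ^^ t) s = s' \<Longrightarrow> (step w P ^^ u) s' = s'' \<Longrightarrow> (step w P ^^ (t + u)) s = s''"
  by (simp add: add.commute[of t u] funpow_add)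

lemma run_halted: "halted P s \<Longrightarrow> (step w P ^^ t) s = s"
  by (induction t) (simp_all add: step_def)

text \<open>The registers that both loops leave unchanged; registers 10 and 11 carry the loop
  state.\<close>

definition environment :: "(nat \<Rightarrow> nat) \<Rightarrow> nat \<Rightarrow> nat \<Rightarrow> nat \<Rightarrow> nat \<Rightarrow> nat \<Rightarrow> nat \<Rightarrow> nat \<Rightarrow> bool" where
  "environment R r c b Q imax J k \<longleftrightarrow> R 0 = r \<and> R 1 = c \<and> R 3 = 1 \<and> R 4 = 2 ^ b \<and> R 5 = b \<and>
     R 6 = Q \<and> R 7 = imax \<and> R 8 = J \<and> R 9 = k \<and> R 12 = 2"

lemma environment_cong:
  assumes "environment R r c b Q imax J k" "\<forall>i\<in>{0,1,3,4,5,6,7,8,9,12}. R' i = R i"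
  shows "environment R' r c b Q imax J k"
  using assms by (simp add: environment_def)

text \<open>The fields \<open>fs\<close> are: 8 header fields; for every row \<open>r\<close> and \<open>i < imax\<close> the first column in which
  \<open>a r\<close> reaches \<open>(i + 1) * k\<close>; and the tree for \<open>a div (k * J)\<close>, whose entries \<open>ent e R C\<close> contain
  absolute field indices.\<close>

locale query_structure =
  fixes w b Q imax J k e0 J0 n :: nat and fs :: "nat list"
    and ent :: "nat \<Rightarrow> nat \<Rightarrow> nat \<Rightarrow> nat" and a :: "nat \<Rightarrow> nat \<Rightarrow> nat"
  assumes fs_less: "\<forall>x\<in>set fs. x < 2 ^ b"
    and Q: "8 \<le> Q" "b * Q \<le> w" and b: "0 < b" and len: "length fs \<le> 2 ^ b" "8 \<le> length fs"
    and header: "fs ! 0 = 2 ^ (b - 1)" "fs ! 1 = b" "fs ! 2 = Q" "fs ! 3 = imax" "fs ! 4 = J"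
      "fs ! 5 = k" "fs ! 6 = e0" "fs ! 7 = ent e0 0 0"
    and e0: "e0 \<le> b" "e0 < 2 ^ J0" "n \<le> 2 ^ e0" and k: "1 \<le> k" and J: "1 \<le> J"
    and a: "r < n \<Longrightarrow> c < n \<Longrightarrow> a r c + k < 2 ^ b"
    and descend: "r < n \<Longrightarrow> c < n \<Longrightarrow> e = e0 div 2 ^ i \<Longrightarrow> x = ent e (r div 2 ^ e) (c div 2 ^ e) \<Longrightarrow>
      p = 2 ^ (e - e div 2) \<Longrightarrow>
      idx = x div 2 + r div 2 ^ (e div 2) mod p * p + c div 2 ^ (e div 2) mod p \<Longrightarrow>
      if odd x then x div 2 = a r c div (k * J)
      else 0 < e \<and> idx < length fs \<and> fs ! idx = ent (e div 2) (r div 2 ^ (e div 2)) (c div 2 ^ (e div 2))"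
    and scan: "r < n \<Longrightarrow> c < n \<Longrightarrow> i < imax \<Longrightarrow>
      r * imax + i + 8 < length fs \<and> (fs ! (r * imax + i + 8) \<le> c \<longleftrightarrow> (i + 1) * k \<le> a r c)"
    and imax: "r < n \<Longrightarrow> c < n \<Longrightarrow> J = 1 \<or> a r c div k \<le> imax"
begin

abbreviation "M \<equiv> packed b Q fs"

lemma b_less_w: "b < w"
proof -
  have "b * 8 \<le> b * Q" using Q by simp
  then show ?thesis using Q b by linarith
qed

lemma word_bounds: "(2::nat) ^ b < 2 ^ w" "x \<le> w \<Longrightarrow> x < 2 ^ w"
  using b_less_w by (auto intro: le_less_trans)

lemma read:
  assumes "i < length fs"
  shows "M (i div Q) div 2 ^ (i mod Q * b) mod 2 ^ b = fs ! i" "i < 2 ^ w" "i mod Q * b < 2 ^ w"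
proof -
  show "M (i div Q) div 2 ^ (i mod Q * b) mod 2 ^ b = fs ! i"
    using fs_less assms Q by (intro packed_read) auto
  show "i < 2 ^ w" using assms len word_bounds(1) by linarith
  have "i mod Q * b \<le> Q * b" using Q by (intro mult_le_mono1) (simp add: less_imp_le)
  also have "\<dots> \<le> w" using Q by (simp add: mult.commute)
  finally show "i mod Q * b < 2 ^ w" by (rule word_bounds)
qed

lemma run_leaf_value:
  assumes rc: "r < n" "c < n" and R: "environment R r c b Q imax J k" "R 11 = x"
    and x: "odd x" "x div 2 = a r c div (k * J)"
  shows "\<exists>R'. (step w prog ^^ 4) (State 20 R M) = State 43 R' M \<and>
    environment R' r c b Q imax J k \<and> R' 11 = a r c div (k * J) * J"
proof -
  have "a r c div (k * J) * J \<le> a r c div (k * J) * (k * J)" using k by simp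
  also have "\<dots> \<le> a r c" by simp
  finally have le: "a r c div (k * J) * J < 2 ^ w" using a[OF rc] word_bounds(1) by linarith
  have "\<exists>R'. (step w prog ^^ 4) (State 20 R M) = State 43 R' M \<and>
    (\<forall>i\<in>{0,1,3,4,5,6,7,8,9,12}. R' i = R i) \<and> R' 11 = x div 2 * J"
    by (rule run_leaf) (use R x le in \<open>auto simp: environment_def\<close>)
  then show ?thesis using environment_cong[OF R(1)] x(2) by auto
qed

text \<open>\<open>l\<close> bounds the halvings left: \<open>e < 2 ^ 0\<close> forces
  \<open>e = 0\<close>, where \<open>descend\<close> admits only an odd entry. \<open>i\<close>
  records the origin of \<open>e\<close>, as \<open>descend\<close> speaks only of exponents
  \<open>e0 div 2 ^ i\<close>.\<close>

lemma run_descend_loop: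
  assumes rc: "r < n" "c < n"
  shows "environment R r c b Q imax J k \<Longrightarrow> R 10 = e \<Longrightarrow> R 11 = ent e (r div 2 ^ e) (c div 2 ^ e) \<Longrightarrow>
    e = e0 div 2 ^ i \<Longrightarrow> e < 2 ^ l \<Longrightarrow>
    \<exists>t R'. t \<le> 21 * l + 4 \<and> (step w prog ^^ t) (State 20 R M) = State 43 R' M \<and>
      environment R' r c b Q imax J k \<and> R' 11 = a r c div (k * J) * J"
proof (induction l arbitrary: R e i)
  case l: 0
  let ?x = "ent e (r div 2 ^ e) (c div 2 ^ e)"
  have odd: "odd ?x" "?x div 2 = a r c div (k * J)"
    using descend[OF rc \<open>e = e0 div 2 ^ i\<close> refl refl refl] \<open>e < 2 ^ 0\<close> by (auto split: if_splits)
  from run_leaf_value[OF rc l.prems(1,3) odd]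
  show ?case by (intro exI[of _ 4]) auto
next
  case (Suc l)
  let ?x = "ent e (r div 2 ^ e) (c div 2 ^ e)"
  note d = descend[OF rc \<open>e = e0 div 2 ^ i\<close> refl refl refl]
  show ?case
  proof (cases "odd ?x")
    case True
    then have odd: "odd ?x" "?x div 2 = a r c div (k * J)" using d by (auto split: if_splits)
    from run_leaf_value[OF rc Suc.prems(1,3) odd]
    show ?thesis by (intro exI[of _ 4]) auto
  next
    case False
    define p where "p = (2::nat) ^ (e - e div 2)"
    define idx where "idx = ?x div 2 + r div 2 ^ (e div 2) mod p * p + c div 2 ^ (e div 2) mod p"
    let ?v = "ent (e div 2) (r div 2 ^ (e div 2)) (c div 2 ^ (e div 2))"
    have idx: "idx < length fs" "fs ! idx = ?v" using d False unfolding idx_def p_def by auto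
    have "e \<le> e0" using Suc.prems(4) by simp
    then have ew: "e < w" using e0 b_less_w by linarith
    have ev: "even ?x" using False by simp
    have E: "R 0 = r" "R 1 = c" "R 3 = 1" "R 4 = 2 ^ b" "R 5 = b" "R 6 = Q" "R 12 = 2"
      using Suc.prems(1) by (simp_all add: environment_def)
    from ew have ov: "p < 2 ^ w" "e < 2 ^ w" unfolding p_def by (auto intro: word_bounds)
    have "\<exists>R'. (step w prog ^^ 21) (State 20 R M) = State 20 R' M \<and>
      (\<forall>i\<in>{0,1,3,4,5,6,7,8,9,12}. R' i = R i) \<and> R' 10 = e div 2 \<and> R' 11 = ?v"
      by (rule run_descend[OF E(1-6) Suc.prems(2,3) E(7) ev p_def idx_def read(2,3)[OF idx(1)] ov])
        (use read(1)[OF idx(1)] idx(2) in simp)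
    then obtain R1 where R1: "(step w prog ^^ 21) (State 20 R M) = State 20 R1 M"
      "environment R1 r c b Q imax J k" "R1 10 = e div 2" "R1 11 = ?v"
      using environment_cong[OF Suc.prems(1)] by blast
    have "e div 2 = e0 div 2 ^ Suc i" using Suc.prems(4) by (simp only: power_Suc2 div_mult2_eq)
    moreover have "e div 2 < 2 ^ l" using Suc.prems(5) by simp
    ultimately obtain t R' where "t \<le> 21 * l + 4" "(step w prog ^^ t) (State 20 R1 M) = State 43 R' M"
      "environment R' r c b Q imax J k" "R' 11 = a r c div (k * J) * J"
      using Suc.IH[OF R1(2-4)] by blast
    then show ?thesis using run_trans[OF R1(1)] by (intro exI[of _ "21 + t"] exI[of _ R']) auto
  qed
qed

text \<open>\<open>l\<close> bounds the advances left. The last premise admits a table that is too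
  short, even empty, provided the starting index is already exact.\<close>

lemma run_scan_loop:
  assumes rc: "r < n" "c < n"
  shows "environment R r c b Q imax J k \<Longrightarrow> R 11 = i \<Longrightarrow> i \<le> a r c div k \<Longrightarrow> a r c div k \<le> i + l \<Longrightarrow>
    a r c div k \<le> imax \<or> i = a r c div k \<Longrightarrow>
    \<exists>t R'. t \<le> 14 * l + 12 \<and> (step w prog ^^ t) (State 43 R M) = State 58 R' M \<and>
      environment R' r c b Q imax J k \<and> R' 11 = a r c div k"
proof (induction l arbitrary: R i)
  case l: 0
  then have i: "i = a r c div k" by simp
  show ?case
  proof (cases "i < imax")
    case False
    then show ?thesis using run_scan_end[of R imax i w M] l.prems i
      by (intro exI[of _ 2] exI[of _ R]) (auto simp: environment_def)
  next
    case True
    define idx where "idx = r * imax + i + 8"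
    have idx: "idx < length fs" and "c < fs ! idx"
      using scan[OF rc True] dividend_less_div_times[of k "a r c"] i k unfolding idx_def by auto
    then have "\<exists>R'. (step w prog ^^ (if c < fs ! idx then 12 else 14)) (State 43 R M) = State (if c < fs ! idx then 58 else 43) R' M \<and>
    (\<forall>j\<in>{0,1,3,4,5,6,7,8,9,12}. R' j = R j) \<and> R' 11 = (if c < fs ! idx then i else i + 1)"
      by (intro run_scan[of R r c "2 ^ b" b Q imax i idx])
       (use l.prems True read[OF idx] in \<open>auto simp: environment_def idx_def\<close>)
    then show ?thesis using environment_cong[OF l.prems(1)] i \<open>c < fs ! idx\<close> by (intro exI[of _ 12]) fastforce
  qed
next
  case (Suc l)
  show ?case
  proof (cases "i = a r c div k")
    case True
    then obtain t R' where "t \<le> 14 * l + 12" "(step w prog ^^ t) (State 43 R M) = State 58 R' M"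
      "environment R' r c b Q imax J k" "R' 11 = a r c div k" using Suc.IH[OF Suc.prems(1-3)] by auto
    then show ?thesis by (intro exI[of _ t] exI[of _ R']) auto
  next
    case False
    then have i: "i < a r c div k" "i < imax" using Suc.prems by auto
    define idx where "idx = r * imax + i + 8"
    have "i + 1 \<le> a r c div k" using i by simp
    then have "(i + 1) * k \<le> a r c" using k by (simp add: less_eq_div_iff_mult_less_eq del: mult_Suc)
    then have idx: "idx < length fs" and nl: "\<not> c < fs ! idx"
      using scan[OF rc i(2)] unfolding idx_def by auto
    then have "\<exists>R'. (step w prog ^^ (if c < fs ! idx then 12 else 14)) (State 43 R M) = State (if c < fs ! idx then 58 else 43) R' M \<and>
    (\<forall>j\<in>{0,1,3,4,5,6,7,8,9,12}. R' j = R j) \<and> R' 11 = (if c < fs ! idx then i else i + 1)"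
      by (intro run_scan[of R r c "2 ^ b" b Q imax i idx])
       (use Suc.prems i read[OF idx] in \<open>auto simp: environment_def idx_def\<close>)
    then obtain R1 where R1: "(step w prog ^^ 14) (State 43 R M) = State 43 R1 M"
      "environment R1 r c b Q imax J k" "R1 11 = i + 1"
      using environment_cong[OF Suc.prems(1)] nl by auto
    obtain t R' where "t \<le> 14 * l + 12" "(step w prog ^^ t) (State 43 R1 M) = State 58 R' M"
      "environment R' r c b Q imax J k" "R' 11 = a r c div k"
      using Suc.IH[OF R1(2-3)] i Suc.prems by auto
    then show ?thesis using run_trans[OF R1(1)] by (intro exI[of _ "14 + t"] exI[of _ R']) auto
  qed
qed

lemma run_query:
  assumes rc: "r < n" "c < n" and R: "R 0 = r" "R 1 = c" "R 2 = 0"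
  shows "\<exists>t R'. t \<le> 21 * J0 + 14 * J + 39 \<and> (step w prog ^^ t) (State 0 R M) = State 61 R' M \<and>
    R' 0 = a r c div k * k + k - 1"
proof -
  let ?x = "M 0" and ?B = "(2::nat) ^ b"
  have hd: "?x div ?B ^ i mod ?B = fs ! i" if "i < 8" for i
    using that Q len by (intro packed_header fs_less) auto
  \<comment> \<open>With \<open>2 ^ (b - 1)\<close> as its lowest field, the first word is an odd
    multiple of \<open>2 ^ (b - 1)\<close>, as the xor identity requires.\<close>
  have "?x mod ?B = 2 ^ (b - 1)" using hd[of 0] header by simp
  then have "?x = 2 ^ (b - 1) + ?x div ?B * ?B" using div_mult_mod_eq[of ?x ?B] by linarith
  also have "?B = 2 * 2 ^ (b - 1)" using b by (simp add: power_eq_if)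
  finally have x: "?x = 2 ^ (b - 1) * (2 * (?x div (2 * 2 ^ (b - 1))) + 1)" by (simp add: algebra_simps)
  then obtain y where y: "?x = 2 ^ (b - 1) * (2 * y + 1)" by blast
  have xor: "xor ?x (?x - 1) + 1 = ?B"
    unfolding y xor_pred_odd_multiple using b by simp
  have "0 < 2 ^ (b - 1) * (2 * y + 1)" by simp
  then have "1 \<le> ?x" using y by linarith
  have "?x < 2 ^ (b * Q)" by (rule packed_less[OF fs_less])
  also have "\<dots> \<le> 2 ^ w" using Q by simp
  finally have "?x < 2 ^ w" .
  have "(2::nat) ^ 1 < 2 ^ w" using b b_less_w by (intro power_strict_increasing) auto
  then have w2: "(2::nat) < 2 ^ w" by simp
  from run_init[where M = M and R = R, OF refl R(3) w2 \<open>1 \<le> ?x\<close> \<open>?x < 2 ^ w\<close> xor word_bounds(1)]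
  obtain R1 where "(step w prog ^^ 20) (State 0 R M) = State 20 R1 M" "environment R1 r c b Q imax J k"
    "R1 10 = e0" "R1 11 = ent e0 0 0"
    using hd[of 1] hd[of 2] hd[of 3] hd[of 4] hd[of 5] hd[of 6] hd[of 7] header R
    unfolding environment_def by auto
  note R1 = this
  have "r div 2 ^ e0 = 0" "c div 2 ^ e0 = 0" using rc e0 by auto
  then obtain t2 R2 where R2: "t2 \<le> 21 * J0 + 4" "(step w prog ^^ t2) (State 20 R1 M) = State 43 R2 M"
    "environment R2 r c b Q imax J k" "R2 11 = a r c div (k * J) * J"
    using run_descend_loop[OF rc R1(2,3), of 0 J0] R1(4) e0(2) by auto
  \<comment> \<open>\<open>?i\<close> is \<open>a r c div k\<close> rounded down to a multiple of
    \<open>J\<close>, so fewer than \<open>J\<close> advances reach the exact quotient.\<close>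
  let ?i = "a r c div (k * J) * J"
  have i: "?i = a r c div k div J * J" by (simp add: div_mult2_eq)
  have i1: "?i \<le> a r c div k" unfolding i by simp
  have "a r c div k = ?i + a r c div k mod J" unfolding i by simp
  moreover have "a r c div k mod J < J" using J by simp
  ultimately have i2: "a r c div k \<le> ?i + J" by linarith
  have "a r c div k \<le> imax \<or> ?i = a r c div k" using imax[OF rc] by auto
  from run_scan_loop[OF rc R2(3,4) i1 i2 this] obtain t3 R3 where
    R3: "t3 \<le> 14 * J + 12" "(step w prog ^^ t3) (State 43 R2 M) = State 58 R3 M"
    "environment R3 r c b Q imax J k" "R3 11 = a r c div k" by blast
  have "a r c div k * k + k \<le> a r c + k" by simp
  then have "a r c div k * k + k < 2 ^ w" using a[OF rc] word_bounds(1) by linarith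
  then obtain R4 where R4: "(step w prog ^^ 3) (State 58 R3 M) = State 61 R4 M"
    "R4 0 = a r c div k * k + k - 1"
    using run_output[of R3 k "a r c div k" w M] R3(3,4) k unfolding environment_def by auto
  \<comment> \<open>The steps add up as 20 for the initialisation, \<open>21 * J0 + 4\<close> for
    the descent, \<open>14 * J + 12\<close> for the scan and 3 for the output.\<close>
  from run_trans[OF run_trans[OF run_trans[OF R1(1) R2(2)] R3(2)] R4(1)]
  show ?thesis using R2(1) R3(1) R4(2) by (intro exI[of _ "20 + t2 + t3 + 3"] exI[of _ R4]) auto
qed

text \<open>\<open>answers\<close> looks at the state after exactly \<open>T\<close> steps; a halted
  machine keeps its state, so any upper bound on the running time can serve as
  \<open>T\<close>.\<close>

lemma answers_query:
  assumes rc: "r < n" "c < n" and D: "mem_of_bits w D = M" and T: "21 * J0 + 14 * J + 39 \<le> T"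
  shows "answers w prog D r c T (a r c div k * k + k - 1)"
proof -
  obtain t R' where t: "t \<le> 21 * J0 + 14 * J + 39" "(step w prog ^^ t) (init w D r c) = State 61 R' M"
    "R' 0 = a r c div k * k + k - 1"
    using run_query[OF rc, of "(\<lambda>_. 0)(0 := r, 1 := c)"] unfolding init_def D by auto
  have "halted prog (State 61 R' M)" by (simp add: halted_def length_prog)
  moreover have "(step w prog ^^ (t + (T - t))) (init w D r c) = State 61 R' M"
    using run_trans[OF t(2) run_halted] calculation by simp
  moreover have "t + (T - t) = T" using t(1) T by simp
  ultimately show ?thesis using t(3) D by (simp add: answers_def)
qed

end

section \<open>Space and time bounds\<close>

text \<open>Header, table and tree are laid out in this order. \<open>J\<close>, \<open>imax\<close>
  and \<open>S\<close> stay free to cover both the two-stage search and the exact storage of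
  \<open>a\<close>. By \<open>fit\<close>, every field, including the doubled addresses in the tree,
  has at most \<open>b\<close> bits.\<close>

lemma structure_ex:
  fixes a :: "nat \<Rightarrow> nat \<Rightarrow> nat"
  assumes n: "n \<le> 2 ^ e0" and a_mono: "\<And>r r' c c'. r \<le> r' \<Longrightarrow> c \<le> c' \<Longrightarrow> a r c \<le> a r' c'"
    and a_less: "\<And>r c. a r c < m"
    and k: "1 \<le> k" "k \<le> n" and J: "1 \<le> J" and imax: "J = 1 \<or> (m - 1) div k \<le> imax"
    and e0: "e0 < 2 ^ J0" "e0 \<le> b" and b: "0 < b" "8 * b \<le> w"
    and S: "4 * J0 * 2 ^ e0 * ((m - 1) div (k * J)) \<le> S \<or> 2 * J0 * 4 ^ e0 \<le> S"
    and fit: "18 + 2 * (n * imax) + 2 * S + 2 * m + 2 * n + 2 * J \<le> 2 ^ b"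
    and T: "21 * J0 + 14 * J + 39 \<le> T"
  shows "\<exists>D. length D \<le> 4 * b * (8 + n * imax + S) \<and>
    (\<forall>r<n. \<forall>c<n. answers w prog D r c T (a r c div k * k + k - 1))"
proof -
  define g where "g r c = a r c div (k * J)" for r c
  interpret monotone_grid g "(m - 1) div (k * J)"
  proof
    show "g r c \<le> g r' c'" if "r \<le> r'" "c \<le> c'" for r r' c c'
      unfolding g_def by (intro div_le_mono a_mono that)
    show "g r c \<le> (m - 1) div (k * J)" for r c
      unfolding g_def using a_less[of r c] by (intro div_le_mono) simp
  qed
  define off where "off = 8 + n * imax"
  obtain L ent where L: "length L \<le> 4 * J0 * 2 ^ e0 * ((m - 1) div (k * J))" "length L \<le> 2 * J0 * 4 ^ e0"
    and ent: "\<forall>x \<in> insert (ent e0 0 0) (set L). x \<le> 2 * (off + length L + (m - 1) div (k * J)) + 1"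
    and walk: "\<forall>i r c. r < 2 ^ e0 \<and> c < 2 ^ e0 \<longrightarrow>
      (let e = e0 div 2 ^ i; x = ent e (r div 2 ^ e) (c div 2 ^ e); p = 2 ^ (e - e div 2);
           idx = x div 2 + r div 2 ^ (e div 2) mod p * p + c div 2 ^ (e div 2) mod p
       in if odd x then x div 2 = g r c
          else 0 < e \<and> off \<le> idx \<and> idx < off + length L \<and>
            L ! (idx - off) = ent (e div 2) (r div 2 ^ (e div 2)) (c div 2 ^ (e div 2)))"
    using quadtree_ex[OF e0(1), of off] by (elim exE conjE)
  have LS: "length L \<le> S" using L S by auto
  \<comment> \<open>The disjunct \<open>n \<le> c\<close> guarantees a minimum and yields
    \<open>n\<close>, beyond every queried column, if the row stays below the threshold.\<close>
  define F where "F r i = (LEAST c. n \<le> c \<or> (i + 1) * k \<le> a r c)" for r i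
  have F_le: "F r i \<le> n" for r i unfolding F_def by (rule Least_le) simp
  have F: "F r i \<le> c \<longleftrightarrow> (i + 1) * k \<le> a r c" if "c < n" for r i c
  proof
    assume le: "F r i \<le> c"
    have "n \<le> F r i \<or> (i + 1) * k \<le> a r (F r i)"
      unfolding F_def by (rule LeastI[of _ n]) simp
    then show "(i + 1) * k \<le> a r c" using le that a_mono[OF order_refl le, of r] by linarith
  next
    assume "(i + 1) * k \<le> a r c"
    then show "F r i \<le> c" unfolding F_def by (intro Least_le) simp
  qed
  define tab where "tab = map (\<lambda>j. F (j div imax) (j mod imax)) [0..<n * imax]"
  \<comment> \<open>The cap by the number of fields also keeps \<open>Q\<close> below
    \<open>2 ^ b\<close>, so that it can be stored in the header.\<close>
  define Q where "Q = min (w div b) (off + length L)"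
  define hdr where "hdr = [2 ^ (b - 1), b, Q, imax, J, k, e0, ent e0 0 0]"
  define fs where "fs = hdr @ tab @ L"
  have len_fs: "length fs = off + length L" by (simp add: fs_def hdr_def tab_def off_def)
  have "8 \<le> w div b" using b by (simp add: less_eq_div_iff_mult_less_eq)
  then have Q8: "8 \<le> Q" by (simp add: Q_def off_def)
  have "b * Q \<le> b * (w div b)" by (simp add: Q_def)
  also have "\<dots> \<le> w" by simp
  finally have Qb: "b * Q \<le> w" .
  have bb: "b < 2 ^ b" by simp
  have "(m - 1) div (k * J) \<le> m" by (meson diff_le_self div_le_dividend le_trans)
  moreover have "2 * (off + length L + G) + 1 < 2 ^ b" if "G \<le> m" for G
  proof -
    have "17 + 2 * (n * imax) + 2 * length L + 2 * G < 2 ^ b" using that fit LS by linarith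
    then show ?thesis by (simp add: off_def)
  qed
  ultimately have big: "2 * (off + length L + (m - 1) div (k * J)) + 1 < 2 ^ b" by blast
  have "(2::nat) ^ (b - 1) < 2 ^ b" using b by simp
  moreover have "Q < 2 ^ b"
  proof -
    have "off + length L < 2 ^ b" using big by simp
    then show ?thesis unfolding Q_def by (simp add: min_less_iff_disj)
  qed
  moreover have "imax < 2 ^ b"
  proof -
    have "imax \<le> n * imax" using k by simp
    then show ?thesis using fit by linarith
  qed
  moreover have "J < 2 ^ b" "k < 2 ^ b" "e0 < 2 ^ b" using fit k e0 bb by linarith+
  moreover have "ent e0 0 0 < 2 ^ b" "\<forall>x\<in>set L. x < 2 ^ b" using ent big by force+
  moreover have "F r i < 2 ^ b" for r i using F_le[of r i] fit by linarith
  ultimately have fs_less: "\<forall>x\<in>set fs. x < 2 ^ b"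
    using bb by (auto simp: fs_def hdr_def tab_def)
  have fs_tab: "fs ! (j + 8) = tab ! j" if "j < n * imax" for j
    using that by (simp add: fs_def hdr_def nth_append tab_def)
  have fs_L: "fs ! idx = L ! (idx - off)" if "off \<le> idx" "idx < off + length L" for idx
  proof -
    have "length (hdr @ tab) = off" by (simp add: hdr_def tab_def off_def)
    then have "((hdr @ tab) @ L) ! idx = L ! (idx - off)" using that(1) by (metis leD nth_append)
    then show ?thesis by (simp add: fs_def)
  qed
  interpret query_structure w b Q imax J k e0 J0 n fs ent a
  proof
    show "\<forall>x\<in>set fs. x < 2 ^ b" "8 \<le> Q" "b * Q \<le> w" "0 < b" by fact+
    show "length fs \<le> 2 ^ b" "8 \<le> length fs" using big unfolding len_fs off_def by auto
    show "fs ! 0 = 2 ^ (b - 1)" "fs ! 1 = b" "fs ! 2 = Q" "fs ! 3 = imax" "fs ! 4 = J"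
      "fs ! 5 = k" "fs ! 6 = e0" "fs ! 7 = ent e0 0 0" by (simp_all add: fs_def hdr_def)
    show "e0 \<le> b" "e0 < 2 ^ J0" "n \<le> 2 ^ e0" "1 \<le> k" "1 \<le> J" by fact+
  next
    fix r c
    show "a r c + k < 2 ^ b" using a_less[of r c] fit k(2) by linarith
    show "J = 1 \<or> a r c div k \<le> imax"
    proof -
      have "a r c div k \<le> (m - 1) div k" using a_less[of r c] by (intro div_le_mono) simp
      then show ?thesis using imax by linarith
    qed
  next
    fix r c e i x p idx assume h: "r < n" "c < n" "e = e0 div 2 ^ i"
      "x = ent e (r div 2 ^ e) (c div 2 ^ e)" "p = 2 ^ (e - e div 2)"
      "idx = x div 2 + r div 2 ^ (e div 2) mod p * p + c div 2 ^ (e div 2) mod p"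
    have "r < 2 ^ e0" "c < 2 ^ e0" using h n by auto
    then have "if odd x then x div 2 = g r c
          else 0 < e \<and> off \<le> idx \<and> idx < off + length L \<and>
            L ! (idx - off) = ent (e div 2) (r div 2 ^ (e div 2)) (c div 2 ^ (e div 2))"
      using walk[rule_format, of r c i] unfolding Let_def h(3-6) by blast
    then show "if odd x then x div 2 = a r c div (k * J)
      else 0 < e \<and> idx < length fs \<and> fs ! idx = ent (e div 2) (r div 2 ^ (e div 2)) (c div 2 ^ (e div 2))"
      using fs_L[of idx] by (auto simp: g_def len_fs split: if_splits)
  next
    fix r c i assume h: "r < n" "c < n" "i < imax"
    have "r * imax + i < (r + 1) * imax" using h by simp
    also have "\<dots> \<le> n * imax" using h by (intro mult_le_mono1) simp
    finally have lt: "r * imax + i < n * imax" .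
    then have "fs ! (r * imax + i + 8) = F r i"
      unfolding fs_tab[OF lt] using h by (simp add: tab_def)
    then show "r * imax + i + 8 < length fs \<and> (fs ! (r * imax + i + 8) \<le> c \<longleftrightarrow> (i + 1) * k \<le> a r c)"
      using lt F[OF h(2), of r i] by (simp add: len_fs off_def)
  qed
  obtain D where D: "length D \<le> 4 * b * length fs" "mem_of_bits w D = packed b Q fs"
    using packed_layout[OF fs_less b(1) Q_def[folded len_fs]] Q8 by auto
  have "4 * b * length fs \<le> 4 * b * (8 + n * imax + S)"
    unfolding len_fs off_def using LS by (intro mult_le_mono2) simp
  with D(1) have "length D \<le> 4 * b * (8 + n * imax + S)" by linarith
  then show ?thesis using answers_query[OF _ _ D(2) T] by blast
qed

section \<open>Rounded logarithms\<close>

lemma le_floor_log_iff: "0 < x \<Longrightarrow> i \<le> floor_log x \<longleftrightarrow> 2 ^ i \<le> x"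
  by (metis (no_types, lifting) floor_log_exp2_le floor_log_le_iff floor_log_power le_trans one_le_numeral power_increasing)

lemma less_exp_floor_log: "x < 2 ^ (floor_log x + 1)"
  using floor_log_exp2_gt[of x] by simp

lemma real_floor_log_le: "0 < x \<Longrightarrow> real (floor_log x) \<le> log 2 (real x)"
  using floor_log_exp2_le[of x] by (intro le_log_of_power) (simp_all flip: of_nat_power)

text \<open>The number of binary digits of \<open>floor_log n + 1\<close>, the exponent of the grid
  side; it bounds the number of tree levels.\<close>

definition loglog :: "nat \<Rightarrow> nat" where
  "loglog n = floor_log (floor_log n + 1) + 1"

lemma loglog_bigo: "(\<lambda>n. real (35 * loglog n + 39)) \<in> O(\<lambda>n. log 2 (log 2 (real n)))"
\<comment> \<open>For \<open>n \<ge> 16\<close> the iterated logarithm \<open>x\<close> is at least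
  2, and then \<open>35 * (x + 2) + 39 \<le> 90 * x\<close>.\<close>
proof (rule bigoI[where c = 90], rule eventually_mono[OF eventually_ge_at_top[of 16]])
  fix n :: nat assume n: "16 \<le> n"
  have "log 2 (2 ^ 4) \<le> log 2 (real n)" using n by (intro log_mono) auto
  then have l4: "4 \<le> log 2 (real n)" by (simp only: log_pow_cancel)
  have "log 2 (2 ^ 2) \<le> log 2 (log 2 (real n))" using l4 by (intro log_mono) auto
  then have ll2: "2 \<le> log 2 (log 2 (real n))" by (simp only: log_pow_cancel)
  have "real (floor_log (floor_log n + 1)) \<le> log 2 (real (floor_log n + 1))"
    by (rule real_floor_log_le) simp
  also have "\<dots> \<le> log 2 (2 * log 2 (real n))"
    using real_floor_log_le[of n] n l4 by (intro log_mono) auto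
  also have "\<dots> = 1 + log 2 (log 2 (real n))" using l4 by (subst log_mult) auto
  finally show "norm (real (35 * loglog n + 39)) \<le> 90 * norm (log 2 (log 2 (real n)))"
    using ll2 by (simp add: loglog_def)
qed

lemma square_le_exp: "l * l \<le> 8 * 2 ^ l" for l :: nat
proof (induction l)
  case (Suc l)
  have "l < 2 ^ l" by simp
  then show ?case using Suc unfolding mult_Suc mult_Suc_right power_Suc by linarith
qed simp

lemma floor_log_less: "0 < x \<Longrightarrow> floor_log x < x"
  using floor_log_exp2_le[of x] less_exp[of "floor_log x"] by linarith

text \<open>If \<open>m \<ge> n ^ 5\<close>, the space suffices to store \<open>a\<close> exactly, so \<open>k = J = 1\<close> and the scan is
  disabled by \<open>imax = 0\<close>; otherwise a field has only \<open>O(log n)\<close> bits.\<close>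

lemma structure_small_or_large:
  fixes a :: "nat \<Rightarrow> nat \<Rightarrow> nat"
  assumes n: "2 \<le> n" and a_mono: "\<And>r r' c c'. r \<le> r' \<Longrightarrow> c \<le> c' \<Longrightarrow> a r c \<le> a r' c'"
    and a_less: "\<And>r c. a r c < m"
    and w: "64 * (floor_log (n * m) + 1) \<le> w"
  shows "\<exists>D k. 1 \<le> k \<and> k \<le> floor_log n \<and> length D \<le> 6528 * (n * m) \<and>
    (\<forall>r<n. \<forall>c<n. answers w prog D r c (35 * loglog n + 39) (a r c div k * k + k - 1))"
proof -
  define X where "X = n * m"
  define l where "l = floor_log X + 1"
  define k where "k = floor_log n"
  have m: "1 \<le> m" using a_less[of 0 0] by simp
  have nX: "n \<le> X" and mX: "m \<le> X" using n m by (simp_all add: X_def)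
  have k1: "1 \<le> k" unfolding k_def using n by (subst le_floor_log_iff) auto
  have kn: "k + 1 \<le> n" unfolding k_def using floor_log_less[of n] n by simp
  have pow_k: "2 ^ k \<le> n" unfolding k_def using n by (intro floor_log_exp2_le) simp
  have n_less: "n < 2 ^ (k + 1)" unfolding k_def by (rule less_exp_floor_log)
  have lev: "k + 1 < 2 ^ loglog n" unfolding loglog_def k_def by (rule less_exp_floor_log)
  have loglog1: "1 \<le> loglog n" by (simp add: loglog_def)
  have loglog_n: "loglog n \<le> n" using floor_log_less[of "k + 1"] kn unfolding loglog_def k_def by simp
  have "k \<le> floor_log X" unfolding k_def using nX by (rule floor_log_le_iff)
  then have e0b: "k + 1 \<le> 8 * l" by (simp add: l_def)
  have "1 \<le> floor_log X" using nX n by (subst le_floor_log_iff) auto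
  then have l2: "2 \<le> l" by (simp add: l_def)
  have X_less: "X < 2 ^ l" unfolding l_def by (rule less_exp_floor_log)
  have "2 ^ floor_log X \<le> X" using nX n by (intro floor_log_exp2_le) simp
  then have l_X: "2 ^ l \<le> 2 * X" by (simp add: l_def)
  \<comment> \<open>With \<open>b = 8 * l\<close>, this covers the premise on field sizes: its
    variable terms add up to at most \<open>24 * X\<close>, and
    \<open>18 \<le> 18 * X\<close>.\<close>
  have fit: "42 * X \<le> 2 ^ (8 * l)"
  proof -
    have "(2::nat) ^ 6 \<le> 2 ^ (7 * l)" using l2 by (intro power_increasing) auto
    then have "42 \<le> (2::nat) ^ (7 * l)" by simp
    then have "42 * X \<le> 2 ^ (7 * l) * 2 ^ l" using X_less by (intro mult_le_mono) auto
    also have "\<dots> = 2 ^ (8 * l)" by (simp flip: power_add)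
    finally show ?thesis .
  qed
  \<comment> \<open>A word must hold the eight header fields of \<open>8 * l\<close> bits each,
    whence the factor 64.\<close>
  have wb: "8 * (8 * l) \<le> w" using w by (simp add: l_def X_def)
  note ex = structure_ex[where a = a and n = n and ?e0.0 = "k + 1" and b = "8 * l" and w = w and m = m
      and ?J0.0 = "loglog n" and T = "35 * loglog n + 39", OF less_imp_le[OF n_less] a_mono a_less]
  show ?thesis
  proof (cases "m < n ^ 5")
    case True
    let ?S = "8 * (n * (m div k))"
    have mk: "n * (m div k) \<le> X" unfolding X_def by (intro mult_le_mono2) simp
    have imax_le: "(m - 1) div k \<le> m div k" by (intro div_le_mono) simp
    \<comment> \<open>The factor \<open>loglog n\<close> for the levels cancels against the coarser
      quotient by \<open>k * loglog n\<close>.\<close>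
    have "4 * loglog n * 2 ^ (k + 1) * ((m - 1) div (k * loglog n))
        = 8 * (2 ^ k * ((m - 1) div k div loglog n * loglog n))" by (simp add: div_mult2_eq)
    also have "\<dots> \<le> 8 * (n * (m div k))"
      using pow_k imax_le by (intro mult_le_mono2 mult_le_mono) (auto intro: order_trans[OF div_times_less_eq_dividend])
    finally have S: "4 * loglog n * 2 ^ (k + 1) * ((m - 1) div (k * loglog n)) \<le> ?S" .
    have tab: "n * ((m - 1) div k) \<le> n * (m div k)" using imax_le by (rule mult_le_mono2)
    have "18 + 2 * (n * ((m - 1) div k)) + 2 * ?S + 2 * m + 2 * n + 2 * loglog n \<le> 42 * X"
      using tab mk nX mX loglog_n n by linarith
    then have fit': "18 + 2 * (n * ((m - 1) div k)) + 2 * ?S + 2 * m + 2 * n + 2 * loglog n \<le> 2 ^ (8 * l)"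
      using fit by linarith
    obtain D where D: "length D \<le> 4 * (8 * l) * (8 + n * ((m - 1) div k) + ?S)"
      "\<forall>r<n. \<forall>c<n. answers w prog D r c (35 * loglog n + 39) (a r c div k * k + k - 1)"
      using ex[of k "loglog n" "(m - 1) div k" ?S] k1 kn loglog1 lev e0b l2 wb S fit' by auto
    \<comment> \<open>From \<open>X < n ^ 6\<close> the field width is at most a constant times
      \<open>k\<close>, which the division by \<open>k\<close> in the number of entries pays
      for.\<close>
    have "X < n * n ^ 5" unfolding X_def using True n by simp
    also have "\<dots> = n ^ 6" by (simp add: eval_nat_numeral)
    also have "\<dots> \<le> (2 ^ (k + 1)) ^ 6" using n_less by (intro power_mono) auto
    also have "\<dots> = 2 ^ ((k + 1) * 6)" by (rule power_mult[symmetric])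
    finally have "\<not> (k + 1) * 6 \<le> floor_log X" using nX n by (subst le_floor_log_iff) auto
    then have l12: "l \<le> 12 * k" using k1 unfolding l_def add_mult_distrib by linarith
    \<comment> \<open>The 9 is 1 for the table plus 8 for the tree; the final constant is
      \<open>6528 = 384 * (8 + 9)\<close>.\<close>
    have "length D \<le> 4 * (8 * (12 * k)) * (8 + 9 * (n * (m div k)))"
      using D(1) tab l12 by (elim order_trans) (intro mult_le_mono, auto)
    also have "\<dots> = 384 * (8 * k + 9 * (n * (m div k * k)))" by (simp add: algebra_simps)
    also have "\<dots> \<le> 384 * (8 * X + 9 * (n * m))"
      using kn nX by (intro mult_le_mono2 add_mono) auto
    also have "\<dots> = 6528 * (n * m)" by (simp add: X_def)
    finally show ?thesis using D(2) k1 unfolding k_def by blast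
  next
    case False
    \<comment> \<open>Here the tree is measured by the area bound, which does not depend on
      \<open>m\<close>.\<close>
    let ?S = "8 * loglog n * (n * n)"
    have "n * n ^ 5 \<le> X" unfolding X_def using False by (intro mult_le_mono2) simp
    then have n6: "n ^ 6 \<le> X" by (simp add: eval_nat_numeral)
    have S_le: "?S \<le> 8 * n ^ 3"
    proof -
      have "loglog n * (n * n) \<le> n * (n * n)" using loglog_n by (rule mult_le_mono1)
      then show ?thesis by (simp add: power3_eq_cube mult.assoc)
    qed
    have "n ^ 3 \<le> n ^ 6" using n by (intro power_increasing) auto
    then have n3: "n ^ 3 \<le> X" using n6 by linarith
    have "2 * loglog n * 4 ^ (k + 1) = 8 * loglog n * (2 ^ k * 2 ^ k)"
      by (simp add: power_mult_distrib[symmetric])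
    also have "\<dots> \<le> ?S" using pow_k by (intro mult_le_mono2 mult_le_mono)
    finally have S: "2 * loglog n * 4 ^ (k + 1) \<le> ?S" .
    have "18 + 2 * (n * 0) + 2 * ?S + 2 * m + 2 * n + 2 * 1 \<le> 42 * X" using S_le n3 mX nX n by linarith
    then have fit': "18 + 2 * (n * 0) + 2 * ?S + 2 * m + 2 * n + 2 * 1 \<le> 2 ^ (8 * l)" using fit by linarith
    obtain D where D: "length D \<le> 4 * (8 * l) * (8 + n * 0 + ?S)"
      "\<forall>r<n. \<forall>c<n. answers w prog D r c (35 * loglog n + 39) (a r c div 1 * 1 + 1 - 1)"
      using ex[of 1 1 0 ?S] n loglog1 lev e0b l2 wb S fit' by auto
    \<comment> \<open>Squaring lets \<open>n ^ 6 \<le> X\<close> and the crude bound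
      \<open>l * l \<le> 16 * X\<close> each contribute one factor \<open>X\<close>.\<close>
    have "(l * n ^ 3) ^ 2 = l * l * n ^ 6" by (simp add: eval_nat_numeral)
    also have "\<dots> \<le> 16 * X * X"
    proof -
      have "l * l \<le> 16 * X" using square_le_exp[of l] l_X by linarith
      then show ?thesis using n6 by (rule mult_le_mono)
    qed
    also have "\<dots> = (4 * X) ^ 2" by (simp add: power2_eq_square)
    finally have ln: "l * n ^ 3 \<le> 4 * X" by (rule power2_le_imp_le) simp
    have "1 \<le> n ^ 3" using n by simp
    then have "length D \<le> 4 * (8 * l) * (8 * n ^ 3 + 8 * n ^ 3)"
      using D(1) S_le by (elim order_trans) (intro mult_le_mono2, linarith)
    also have "\<dots> = 512 * (l * n ^ 3)" by simp
    also have "\<dots> \<le> 6528 * X" using ln by linarith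
    finally show ?thesis using D(2) k1 unfolding k_def X_def by (intro exI[of _ D] exI[of _ 1]) auto
  qed
qed

text \<open>Clamping the indices to \<open>n - 1\<close> continues the array constantly past its
  border, which preserves order and range.\<close>

lemma IMS2_clamped:
  assumes A: "A \<in> IMS2 n m" and n: "2 \<le> n"
  defines "a \<equiv> \<lambda>r c. nat (A (min r (n - 1)) (min c (n - 1)))"
  shows "r \<le> r' \<Longrightarrow> c \<le> c' \<Longrightarrow> a r c \<le> a r' c'" and "a r c < m"
    and "r < n \<Longrightarrow> c < n \<Longrightarrow> int (a r c) = A r c"
proof -
  have 1: "i < n \<Longrightarrow> j < n - 1 \<Longrightarrow> A i j \<le> A i (j + 1)"
    and 2: "i < n - 1 \<Longrightarrow> j < n \<Longrightarrow> A i j \<le> A (i + 1) j"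
    and 3: "i < n \<Longrightarrow> j < n \<Longrightarrow> 0 \<le> A i j \<and> A i j < int m" for i j
    using A by (auto simp: IMS2_def)
  have clamp: "min x (n - 1) < n" for x using n by linarith
  have col: "a r c \<le> a r (Suc c)" for r c
  proof (cases "c < n - 1")
    case True
    then have "min (Suc c) (n - 1) = min c (n - 1) + 1" by simp
    then show ?thesis unfolding a_def using 1[of "min r (n - 1)" c] True n by (simp add: nat_mono)
  qed (simp add: a_def min_def)
  have row: "a r c \<le> a (Suc r) c" for r c
  proof (cases "r < n - 1")
    case True
    then have "min (Suc r) (n - 1) = min r (n - 1) + 1" by simp
    then show ?thesis unfolding a_def using 2[of r "min c (n - 1)"] True n by (simp add: nat_mono)
  qed (simp add: a_def min_def)
  show "a r c \<le> a r' c'" if "r \<le> r'" "c \<le> c'"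
    using lift_Suc_mono_le[of "\<lambda>r. a r c", OF row that(1)] lift_Suc_mono_le[of "a r'", OF col that(2)]
    by linarith
  show "a r c < m" using 3[OF clamp clamp, of r c] by (simp add: a_def nat_less_iff)
  show "int (a r c) = A r c" if "r < n" "c < n" proof -
    have "min r (n - 1) = r" "min c (n - 1) = c" using that by linarith+
    then show ?thesis using 3[OF that] by (simp add: a_def)
  qed
qed

theorem theorem11:
  "\<exists>(P :: program) (\<kappa> :: nat) (C :: real) (T :: nat \<Rightarrow> nat).
     1 \<le> \<kappa> \<and>
     (\<lambda>n. real (T n)) \<in> O(\<lambda>n. log 2 (log 2 (real n))) \<and>
     (\<forall>(n :: nat) (m :: nat) (w :: nat) (A :: nat \<Rightarrow> nat \<Rightarrow> int).
        2 \<le> n \<and> real \<kappa> * log 2 (real n * real m) \<le> real w \<and> A \<in> IMS2 n m \<longrightarrow>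
        (\<exists>D :: bool list.
           real (length D) \<le> C * (real n * real m) \<and>
           (\<forall>r < n. \<forall>c < n. \<exists>h :: nat.
              answers w P D r c (T n) h \<and>
              real h - log 2 (real n) < real_of_int (A r c) \<and>
              A r c \<le> int h)))"
proof (intro exI[of _ prog] exI[of _ "128::nat"] exI[of _ "6528::real"] exI[of _ "\<lambda>n. 35 * loglog n + 39"]
    conjI allI impI; (elim conjE)?)
  show "(\<lambda>n. real (35 * loglog n + 39)) \<in> O(\<lambda>n. log 2 (log 2 (real n)))" by (rule loglog_bigo)
next
  fix n m w :: nat and A
  assume n: "2 \<le> n" and w: "real 128 * log 2 (real n * real m) \<le> real w" and A: "A \<in> IMS2 n m"
  define a where "a r c = nat (A (min r (n - 1)) (min c (n - 1)))" for r c
  note a = IMS2_clamped[OF A n, folded a_def]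
  have "1 \<le> m" using a(2)[of 0 0] by simp
  then have nm: "2 \<le> n * m" using n by (metis mult_le_mono mult.right_neutral)
  \<comment> \<open>The logarithm is at least 1, so it absorbs the \<open>+ 1\<close> at the price
    of doubling 64 to 128.\<close>
  have "log 2 2 \<le> log 2 (real (n * m))" using nm by (intro log_mono) (auto simp del: of_nat_mult)
  then have "real (64 * (floor_log (n * m) + 1)) \<le> 128 * log 2 (real (n * m))"
  proof -
    have "0 < n * m" using nm by linarith
    from real_floor_log_le[OF this] show ?thesis using \<open>log 2 2 \<le> _\<close> by simp
  qed
  then have "64 * (floor_log (n * m) + 1) \<le> w" using w by (simp del: of_nat_add)
  from structure_small_or_large[where a = a, OF n a(1,2) this] obtain D k where
    k: "1 \<le> k" "k \<le> floor_log n" and len: "length D \<le> 6528 * (n * m)" and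
    ans: "\<forall>r<n. \<forall>c<n. answers w prog D r c (35 * loglog n + 39) (a r c div k * k + k - 1)"
    by blast
  have kl: "real k \<le> log 2 (real n)" using k(2) real_floor_log_le[of n] n by linarith
  show "\<exists>D. real (length D) \<le> 6528 * (real n * real m) \<and>
      (\<forall>r<n. \<forall>c<n. \<exists>h. answers w prog D r c (35 * loglog n + 39) h \<and>
        real h - log 2 (real n) < real_of_int (A r c) \<and> A r c \<le> int h)"
  proof (intro exI[of _ D] conjI allI impI)
    have "real (length D) \<le> real (6528 * (n * m))" using len by (simp only: of_nat_le_iff)
    then show "real (length D) \<le> 6528 * (real n * real m)" by simp
  next
    fix r c assume rc: "r < n" "c < n"
    let ?h = "a r c div k * k + k - 1"
    \<comment> \<open>\<open>?h\<close> is the largest number with the same quotient by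
      \<open>k\<close> as \<open>a r c\<close>, so it exceeds \<open>a r c\<close> by at most
      \<open>k - 1\<close>.\<close>
    have "a r c mod k < k" using k by simp
    moreover have "a r c = a r c div k * k + a r c mod k" by (simp only: div_mult_mod_eq)
    ultimately have h: "a r c \<le> ?h" "?h + 1 \<le> a r c + k" using k(1) by linarith+
    have "real ?h + 1 \<le> real (a r c) + real k" using h(2) by linarith
    then have "real ?h - log 2 (real n) < real (a r c)" using kl by linarith
    also have "real (a r c) = real_of_int (A r c)" using a(3)[OF rc] by (metis of_int_of_nat_eq)
    finally have "real ?h - log 2 (real n) < real_of_int (A r c)" .
    moreover have "A r c \<le> int ?h" using h(1) a(3)[OF rc] by linarith
    ultimately show "\<exists>h. answers w prog D r c (35 * loglog n + 39) h \<and>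
        real h - log 2 (real n) < real_of_int (A r c) \<and> A r c \<le> int h"
      using ans rc by blast
  qed
qed simp

end
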